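(* Let $\mathbf{k}$ be an algebraically closed field and $\Lambda$ a gentle algebra over $\mathbf{k}$. Suppose $\tau$ is a homotopy band and $\sigma = \tau^n$ (with $n\ge 1$). Let $\lambda \in \mathbf{k}^*$ and let $B^\bullet_{\sigma,\lambda}$ be the complex induced by the unfolded diagram of $\sigma$ in which the scalar $\lambda$ is placed on a direct homotopy letter. Then $$B^\bullet_{\sigma,\lambda} \cong \bigoplus_{i=1}^n B^\bullet_{\tau,\omega^i\mu},$$ where $\mu = \sqrt[n]{\lambda}$ is some fixed $n$-th root of $\lambda$ and $\omega$ is a primitive $n$-th root of unity.
   Context: **Gentle algebras.** $\Lambda=\mathbf{k}Q/I$ is a finite-dimensional algebra, with $Q$ a finite quiver, $I$ generated by paths of length 2, at most two arrows starting and at most two arrows ending at each vertex, and for each arrow $b$: at most one arrow $a$ with $ba$ a path not in $I$, at most one $a$ with $ba$ a path in $I$, at most one arrow $c$ with $cb$ a path not in $I$, and at most one $c$ with $cb$ a path in $I$. For a path or arrow $p$, $s(p)$ and $e(p)$ are its start and end; paths compose right to left. $P(x)$ is the indecomposable projective at $x$; a path $p$ nonzero in $\Lambda$ induces a map $P(e(p))\to P(s(p))$, also denoted $p$; the path $qp$ induces the map "first $q$, then $p$". **Homotopy bands.** A direct homotopy letter is a nontrivial path $p$ nonzero in $\Lambda$; an inverse homotopy letter is a formal inverse $\overline p$, with $s(\overline p)=e(p)$, $e(\overline p)=s(p)$. A (finite) homotopy string is a trivial word at a vertex, or a word $\sigma=\sigma_m\cdots\sigma_1$ of homotopy letters with $s(\sigma_{i+1})=e(\sigma_i)$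 such that for consecutive letters: if both are direct, $\sigma_{i+1}\sigma_i$ is zero because the length two path at the junction is in $I$; if both are inverse, the same holds for $\overline{\sigma_i}\,\overline{\sigma_{i+1}}$; if $\sigma_{i+1}=p$, $\sigma_i=\overline q$, then $p,q$ have different first arrows; if $\sigma_{i+1}=\overline p$, $\sigma_i=q$, then $p,q$ have different last arrows. It is drawn as a diagram labelled from left to right by $\sigma_m,\dots,\sigma_1$, a direct letter being an arrow $\rightarrow$ and an inverse letter an arrow $\leftarrow$; vertices carry cohomological degrees, arrows raising degree by one. A homotopy band is a nontrivial finite homotopy string $\tau$ starting and ending at the same vertex and in the same degree (equally many direct and inverse letters), such that $\tau^2$ is a homotopy string whose letters are the letters of the two copies of $\tau$ (no merging), and $\tau$ is not a proper power. **Complexes.** Let $\sigma=\tau^n$ be a power ($n\geq1$) of a homotopy band $\tau$ and $\lambda\in\mathbf{k}^*$. $B^\bullet_{\sigma,\lambda}$ is the bounded complex of projectives obtained from the cyclic diagram of $\sigma$ (first and last vertex identified): it is the direct sum of the $P(x)$ over the vertices $x$ of this cyclic diagram, placed in their degrees, with differential given by the letters, the scalar $\lambda$ multiplying exactly one direct letter of $\sigma$ (so it appears once for each copy of $\sigma$ in the infinite repeating, i.e. unfolded, diagram). For $n=1$ this is the band complex of $(\tau,\lambda)$, an indecomposable object of $\mathsf{D}^b(\Lambda)$. The complexes $B^\bullet_{\tau,\omega^i\mu}$ are placed in the compatible cohomological degrees. *)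

theory Defs
  imports
    "Graph_Theory.Arc_Walk"
    "HOL-Algebra.QuotRing"
    "HOL-Algebra.Module"
    "HOL-Algebra.Embedded_Algebras"
    "HOL-Computational_Algebra.Polynomial"
begin

section \<open>Path algebras and gentle algebras\<close>

text \<open>
  A quiver is a \<^typ>\<open>('v, 'a) pre_digraph\<close> (parallel arrows and loops are allowed).
  A path is a pair of its start vertex and the list of its arrows \<^emph>\<open>in the order in which they
  are traversed\<close>. As paths compose from right to left, the path written \<open>c b a\<close> is
  \<open>(tail Q a, [a, b, c])\<close>; the trivial path at \<open>x\<close> is \<open>(x, [])\<close>.
\<close>

type_synonym ('v, 'a) qpath = "'v \<times> 'a list"

definition path_start :: "('v, 'a) qpath \<Rightarrow> 'v" where
  "path_start p = fst p"

definition path_end :: "('v, 'a) pre_digraph \<Rightarrow> ('v, 'a) qpath \<Rightarrow> 'v" where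
  "path_end Q p = pre_digraph.awlast Q (fst p) (snd p)"

definition quiver_paths :: "('v, 'a) pre_digraph \<Rightarrow> ('v, 'a) qpath set" where
  "quiver_paths Q = {p. pre_digraph.awalk Q (path_start p) (snd p) (path_end Q p)}"

definition path_of_arrows :: "('v, 'a) pre_digraph \<Rightarrow> 'a list \<Rightarrow> ('v, 'a) qpath" where
  "path_of_arrows Q as = (tail Q (hd as), as)"

text \<open>
  Elements of \<open>kQ\<close> are finitely supported functions on paths. The coefficient of a path \<open>r\<close> in
  \<open>f g\<close> is the sum of \<open>f q * g p\<close> over the factorisations \<open>r = q p\<close> (first \<open>p\<close>, then \<open>q\<close>).
\<close>

definition path_algebra :: "('v, 'a) pre_digraph \<Rightarrow> (('v, 'a) qpath \<Rightarrow> 'k::field) ring" where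
  "path_algebra Q =
    \<lparr> carrier = {f. finite {p. f p \<noteq> 0} \<and> {p. f p \<noteq> 0} \<subseteq> quiver_paths Q},
      monoid.mult = (\<lambda>f g (x, as). \<Sum>i\<le>length as.
        f (path_end Q (x, take i as), drop i as) * g (x, take i as)),
      one = (\<lambda>p. if p \<in> quiver_paths Q \<and> snd p = [] then 1 else 0),
      zero = (\<lambda>p. 0),
      add = (\<lambda>f g p. f p + g p) \<rparr>"

definition path_elem :: "'k::field \<Rightarrow> ('v, 'a) qpath \<Rightarrow> ('v, 'a) qpath \<Rightarrow> 'k" where
  "path_elem c p = (\<lambda>q. if q = p then c else 0)"

abbreviation path_in :: "('v, 'a) qpath \<Rightarrow> (('v, 'a) qpath \<Rightarrow> 'k::field) set \<Rightarrow> bool" where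
  "path_in p I \<equiv> path_elem 1 p \<in> I"

definition bound_algebra ::
  "('v, 'a) pre_digraph \<Rightarrow> (('v, 'a) qpath \<Rightarrow> 'k::field) set \<Rightarrow> (('v, 'a) qpath \<Rightarrow> 'k) set ring"
  where "bound_algebra Q I = path_algebra Q Quot I"

definition bound_class ::
  "('v, 'a) pre_digraph \<Rightarrow> (('v, 'a) qpath \<Rightarrow> 'k::field) set \<Rightarrow> (('v, 'a) qpath \<Rightarrow> 'k)
    \<Rightarrow> (('v, 'a) qpath \<Rightarrow> 'k) set"
  where "bound_class Q I f = I +>\<^bsub>path_algebra Q\<^esub> f"

text \<open>The image of \<open>k\<close> in \<open>kQ/I\<close>: classes of the scalar multiples of the identity.\<close>

definition ground_field ::
  "('v, 'a) pre_digraph \<Rightarrow> (('v, 'a) qpath \<Rightarrow> 'k::field) set \<Rightarrow> (('v, 'a) qpath \<Rightarrow> 'k) set set"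
  where "ground_field Q I = range (\<lambda>c. bound_class Q I (\<lambda>p. c * \<one>\<^bsub>path_algebra Q\<^esub> p))"

text \<open>In the last four assumptions \<open>[a, b]\<close> is the path \<open>b a\<close>.\<close>

locale gentle_algebra = fin_digraph Q
  for Q :: "('v, 'a) pre_digraph" and I :: "(('v, 'a) qpath \<Rightarrow> 'k::field) set" +
  assumes generated_by_length_2:
      "\<exists>R \<subseteq> {p \<in> quiver_paths Q. length (snd p) = 2}. I = Idl\<^bsub>path_algebra Q\<^esub> (path_elem 1 ` R)"
    and finite_dimensional:
      "ring.finite_dimension (bound_algebra Q I) (ground_field Q I) (carrier (bound_algebra Q I))"
    and starting_le_2: "x \<in> verts Q \<Longrightarrow> card {a \<in> arcs Q. tail Q a = x} \<le> 2"
    and ending_le_2: "x \<in> verts Q \<Longrightarrow> card {a \<in> arcs Q. head Q a = x} \<le> 2"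
    and pre_nonzero: "b \<in> arcs Q \<Longrightarrow>
      card {a \<in> arcs Q. head Q a = tail Q b \<and> \<not> path_in (path_of_arrows Q [a, b]) I} \<le> 1"
    and pre_zero: "b \<in> arcs Q \<Longrightarrow>
      card {a \<in> arcs Q. head Q a = tail Q b \<and> path_in (path_of_arrows Q [a, b]) I} \<le> 1"
    and post_nonzero: "b \<in> arcs Q \<Longrightarrow>
      card {c \<in> arcs Q. head Q b = tail Q c \<and> \<not> path_in (path_of_arrows Q [b, c]) I} \<le> 1"
    and post_zero: "b \<in> arcs Q \<Longrightarrow>
      card {c \<in> arcs Q. head Q b = tail Q c \<and> path_in (path_of_arrows Q [b, c]) I} \<le> 1"


section \<open>Homotopy strings and bands\<close>

datatype ('v, 'a) letter = Direct "('v, 'a) qpath" | Inverse "('v, 'a) qpath"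

fun letter_path :: "('v, 'a) letter \<Rightarrow> ('v, 'a) qpath" where
  "letter_path (Direct p) = p"
| "letter_path (Inverse p) = p"

fun letter_start :: "('v, 'a) pre_digraph \<Rightarrow> ('v, 'a) letter \<Rightarrow> 'v" where
  "letter_start Q (Direct p) = path_start p"
| "letter_start Q (Inverse p) = path_end Q p"

fun letter_end :: "('v, 'a) pre_digraph \<Rightarrow> ('v, 'a) letter \<Rightarrow> 'v" where
  "letter_end Q (Direct p) = path_end Q p"
| "letter_end Q (Inverse p) = path_start p"

definition homotopy_letter ::
  "('v, 'a) pre_digraph \<Rightarrow> (('v, 'a) qpath \<Rightarrow> 'k::field) set \<Rightarrow> ('v, 'a) letter \<Rightarrow> bool" where
  "homotopy_letter Q I l \<longleftrightarrow>
    letter_path l \<in> quiver_paths Q \<and> snd (letter_path l) \<noteq> [] \<and> \<not> path_in (letter_path l) I"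

text \<open>\<open>junction Q I l l'\<close> is the condition on consecutive letters \<open>l' l\<close>, i.e. \<open>l\<close> is
  \<open>\<sigma>\<^sub>i\<close> and \<open>l'\<close> is \<open>\<sigma>\<^sub>i\<^sub>+\<^sub>1\<close>.\<close>

fun junction ::
  "('v, 'a) pre_digraph \<Rightarrow> (('v, 'a) qpath \<Rightarrow> 'k::field) set
    \<Rightarrow> ('v, 'a) letter \<Rightarrow> ('v, 'a) letter \<Rightarrow> bool" where
  "junction Q I (Direct p) (Direct p') \<longleftrightarrow>
     path_in (path_of_arrows Q [last (snd p), hd (snd p')]) I"
| "junction Q I (Inverse p) (Inverse p') \<longleftrightarrow>
     path_in (path_of_arrows Q [last (snd p'), hd (snd p)]) I"
| "junction Q I (Inverse q) (Direct p) \<longleftrightarrow> hd (snd p) \<noteq> hd (snd q)"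
| "junction Q I (Direct q) (Inverse p) \<longleftrightarrow> last (snd p) \<noteq> last (snd q)"

text \<open>The word \<open>\<sigma>\<^sub>m \<cdots> \<sigma>\<^sub>1\<close> is the list \<open>[\<sigma>\<^sub>1, \<dots>, \<sigma>\<^sub>m]\<close>, so that its diagram, drawn from left to
  right, is the list read backwards. The empty list stands for any of the trivial words.\<close>

definition homotopy_string ::
  "('v, 'a) pre_digraph \<Rightarrow> (('v, 'a) qpath \<Rightarrow> 'k::field) set \<Rightarrow> ('v, 'a) letter list \<Rightarrow> bool" where
  "homotopy_string Q I w \<longleftrightarrow>
    (\<forall>l \<in> set w. homotopy_letter Q I l) \<and>
    successively (\<lambda>l l'. letter_start Q l' = letter_end Q l \<and> junction Q I l l') w"

definition word_power :: "('v, 'a) letter list \<Rightarrow> nat \<Rightarrow> ('v, 'a) letter list" where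
  "word_power w n = concat (replicate n w)"

fun is_direct :: "('v, 'a) letter \<Rightarrow> bool" where
  "is_direct (Direct p) \<longleftrightarrow> True"
| "is_direct (Inverse p) \<longleftrightarrow> False"

definition homotopy_band ::
  "('v, 'a) pre_digraph \<Rightarrow> (('v, 'a) qpath \<Rightarrow> 'k::field) set \<Rightarrow> ('v, 'a) letter list \<Rightarrow> bool" where
  "homotopy_band Q I w \<longleftrightarrow>
    w \<noteq> [] \<and> homotopy_string Q I w \<and>
    letter_start Q (hd w) = letter_end Q (last w) \<and>
    length (filter is_direct w) = length (filter (\<lambda>l. \<not> is_direct l) w) \<and>
    homotopy_string Q I (word_power w 2) \<and>
    \<not> (\<exists>u k. k \<ge> 2 \<and> w = word_power u k)"


section \<open>Modules and cochain complexes\<close>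

text \<open>The locale \<^locale>\<open>module\<close> requires a commutative ring, hence the following version.\<close>

locale left_module = R?: ring R + M?: abelian_group M
  for R :: "('r, 'x) ring_scheme" (structure) and M :: "('r, 'm, 'y) module_scheme" (structure) +
  assumes smult_closed:
      "\<lbrakk>a \<in> carrier R; x \<in> carrier M\<rbrakk> \<Longrightarrow> a \<odot>\<^bsub>M\<^esub> x \<in> carrier M"
    and smult_l_distr:
      "\<lbrakk>a \<in> carrier R; b \<in> carrier R; x \<in> carrier M\<rbrakk> \<Longrightarrow>
        (a \<oplus> b) \<odot>\<^bsub>M\<^esub> x = a \<odot>\<^bsub>M\<^esub> x \<oplus>\<^bsub>M\<^esub> b \<odot>\<^bsub>M\<^esub> x"
    and smult_r_distr:
      "\<lbrakk>a \<in> carrier R; x \<in> carrier M; y \<in> carrier M\<rbrakk> \<Longrightarrow>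
        a \<odot>\<^bsub>M\<^esub> (x \<oplus>\<^bsub>M\<^esub> y) = a \<odot>\<^bsub>M\<^esub> x \<oplus>\<^bsub>M\<^esub> a \<odot>\<^bsub>M\<^esub> y"
    and smult_assoc:
      "\<lbrakk>a \<in> carrier R; b \<in> carrier R; x \<in> carrier M\<rbrakk> \<Longrightarrow>
        (a \<otimes> b) \<odot>\<^bsub>M\<^esub> x = a \<odot>\<^bsub>M\<^esub> (b \<odot>\<^bsub>M\<^esub> x)"
    and smult_one:
      "x \<in> carrier M \<Longrightarrow> \<one> \<odot>\<^bsub>M\<^esub> x = x"

definition lin_hom ::
  "('r, 'x) ring_scheme \<Rightarrow> ('r, 'm) module \<Rightarrow> ('r, 'n) module \<Rightarrow> ('m \<Rightarrow> 'n) set" where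
  "lin_hom R M N = {f \<in> carrier M \<rightarrow> carrier N.
    (\<forall>x \<in> carrier M. \<forall>y \<in> carrier M. f (x \<oplus>\<^bsub>M\<^esub> y) = f x \<oplus>\<^bsub>N\<^esub> f y) \<and>
    (\<forall>a \<in> carrier R. \<forall>x \<in> carrier M. f (a \<odot>\<^bsub>M\<^esub> x) = a \<odot>\<^bsub>N\<^esub> f x)}"

text \<open>The record type \<^typ>\<open>('r, 'm) module\<close> has fields for a multiplication and an identity, which
  play no role for modules; they are filled arbitrarily below.\<close>

definition module_dsum :: "'i set \<Rightarrow> ('i \<Rightarrow> ('r, 'm) module) \<Rightarrow> ('r, 'i \<Rightarrow> 'm) module" where
  "module_dsum A M =
    \<lparr> carrier = (\<Pi>\<^sub>E i\<in>A. carrier (M i)),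
      monoid.mult = undefined,
      one = undefined,
      zero = (\<lambda>i\<in>A. \<zero>\<^bsub>M i\<^esub>),
      add = (\<lambda>f g. \<lambda>i\<in>A. f i \<oplus>\<^bsub>M i\<^esub> g i),
      module.smult = (\<lambda>a f. \<lambda>i\<in>A. a \<odot>\<^bsub>M i\<^esub> f i) \<rparr>"

record ('r, 'm) cochain =
  obj :: "int \<Rightarrow> ('r, 'm) module"
  diff :: "int \<Rightarrow> 'm \<Rightarrow> 'm"

definition cochain_complex :: "('r, 'x) ring_scheme \<Rightarrow> ('r, 'm) cochain \<Rightarrow> bool" where
  "cochain_complex R C \<longleftrightarrow>
    (\<forall>i. left_module R (obj C i) \<and>
         diff C i \<in> lin_hom R (obj C i) (obj C (i + 1)) \<and>
         (\<forall>x \<in> carrier (obj C i). diff C (i + 1) (diff C i x) = \<zero>\<^bsub>obj C (i + 2)\<^esub>))"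

definition cochain_isomorphic ::
  "('r, 'x) ring_scheme \<Rightarrow> ('r, 'm) cochain \<Rightarrow> ('r, 'n) cochain \<Rightarrow> bool" where
  "cochain_isomorphic R C D \<longleftrightarrow>
    cochain_complex R C \<and> cochain_complex R D \<and>
    (\<exists>\<phi>. \<forall>i. \<phi> i \<in> lin_hom R (obj C i) (obj D i) \<and>
             bij_betw (\<phi> i) (carrier (obj C i)) (carrier (obj D i)) \<and>
             (\<forall>x \<in> carrier (obj C i). \<phi> (i + 1) (diff C i x) = diff D i (\<phi> i x)))"

text \<open>For finite \<open>A\<close>.\<close>

definition cochain_dsum :: "'i set \<Rightarrow> ('i \<Rightarrow> ('r, 'm) cochain) \<Rightarrow> ('r, 'i \<Rightarrow> 'm) cochain" where
  "cochain_dsum A C =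
    \<lparr> obj = (\<lambda>d. module_dsum A (\<lambda>i. obj (C i) d)),
      diff = (\<lambda>d f. \<lambda>i\<in>A. diff (C i) d (f i)) \<rparr>"


section \<open>Band complexes\<close>

text \<open>The left module \<open>P(x) = \<Lambda> e\<^sub>x\<close>, spanned by the classes of the paths starting at \<open>x\<close>. The map
  \<open>P(e(p)) \<rightarrow> P(s(p))\<close> induced by \<open>p\<close> is right multiplication by the class of \<open>p\<close>.\<close>

definition proj_module ::
  "('v, 'a) pre_digraph \<Rightarrow> (('v, 'a) qpath \<Rightarrow> 'k::field) set \<Rightarrow> 'v
    \<Rightarrow> ((('v, 'a) qpath \<Rightarrow> 'k) set, (('v, 'a) qpath \<Rightarrow> 'k) set) module" where
  "proj_module Q I x =
    \<lparr> carrier = (\<lambda>u. u \<otimes>\<^bsub>bound_algebra Q I\<^esub> bound_class Q I (path_elem 1 (x, []))) `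
        carrier (bound_algebra Q I),
      monoid.mult = undefined,
      one = undefined,
      zero = \<zero>\<^bsub>bound_algebra Q I\<^esub>,
      add = (\<oplus>\<^bsub>bound_algebra Q I\<^esub>),
      module.smult = (\<otimes>\<^bsub>bound_algebra Q I\<^esub>) \<rparr>"

text \<open>
  The cyclic diagram of a word \<open>w = [\<sigma>\<^sub>1, \<dots>, \<sigma>\<^sub>m]\<close> has the vertices \<open>0, \<dots>, m - 1\<close>: vertex \<open>j\<close> is the
  start of \<open>w ! j\<close>, whose end is vertex \<open>j + 1 mod m\<close>. A direct letter is drawn as an arrow from its
  end (on the left) to its start (on the right), an inverse letter as an arrow from its start to
  its end. The number \<open>d\<close> is the degree of vertex \<open>0\<close>.
\<close>

definition arrow_source :: "('v, 'a) letter list \<Rightarrow> nat \<Rightarrow> nat" where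
  "arrow_source w j = (if is_direct (w ! j) then Suc j mod length w else j)"

definition arrow_target :: "('v, 'a) letter list \<Rightarrow> nat \<Rightarrow> nat" where
  "arrow_target w j = (if is_direct (w ! j) then j else Suc j mod length w)"

definition vertex_degree :: "int \<Rightarrow> ('v, 'a) letter list \<Rightarrow> nat \<Rightarrow> int" where
  "vertex_degree d w v = d + (\<Sum>j<v. if is_direct (w ! j) then - 1 else 1)"

definition vertices_of_degree :: "int \<Rightarrow> ('v, 'a) letter list \<Rightarrow> int \<Rightarrow> nat set" where
  "vertices_of_degree d w i = {v. v < length w \<and> vertex_degree d w v = i}"

text \<open>\<open>band_complex Q I d w b c\<close> is the complex of \<open>w\<close> with the scalar \<open>c\<close> placed on the letter
  \<open>w ! b\<close>. The component at a vertex \<open>v\<close> of the differential is a sum because up to two letters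
  point to \<open>v\<close>.\<close>

definition band_complex ::
  "('v, 'a) pre_digraph \<Rightarrow> (('v, 'a) qpath \<Rightarrow> 'k::field) set \<Rightarrow> int \<Rightarrow> ('v, 'a) letter list
    \<Rightarrow> nat \<Rightarrow> 'k \<Rightarrow> ((('v, 'a) qpath \<Rightarrow> 'k) set, nat \<Rightarrow> (('v, 'a) qpath \<Rightarrow> 'k) set) cochain" where
  "band_complex Q I d w b c =
    \<lparr> obj = (\<lambda>i. module_dsum (vertices_of_degree d w i)
        (\<lambda>v. proj_module Q I (letter_start Q (w ! v)))),
      diff = (\<lambda>i f. \<lambda>v \<in> vertices_of_degree d w (i + 1).
        \<Oplus>\<^bsub>bound_algebra Q I\<^esub> j \<in> {j. j < length w \<and> arrow_target w j = v}.
          f (arrow_source w j) \<otimes>\<^bsub>bound_algebra Q I\<^esub>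
            bound_class Q I (path_elem (if j = b then c else 1) (letter_path (w ! j)))) \<rparr>"

definition primitive_root_of_unity :: "nat \<Rightarrow> 'k::field \<Rightarrow> bool" where
  "primitive_root_of_unity n \<omega> \<longleftrightarrow> n > 0 \<and> \<omega> ^ n = 1 \<and> (\<forall>k. 0 < k \<and> k < n \<longrightarrow> \<omega> ^ k \<noteq> 1)"

end

theory Submission
  imports Defs
begin

text \<open>
  The diagram of \<open>\<sigma> = \<tau>\<^sup>n\<close> is an \<open>n\<close>-fold cyclic cover of the diagram of \<open>\<tau>\<close>, and the decomposition is
  the discrete Fourier transform along its fibres.

  Let \<open>m\<close> be the length of \<open>\<tau>\<close> and \<open>\<nu>\<^sub>i = \<omega>\<^sup>i \<mu>\<close>. A vertex \<open>p\<close> of the cover lies above \<open>p mod m\<close>, and both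
  carry the same projective module in the same degree. The isomorphism sends the summand at \<open>p\<close> to the
  summand at \<open>p mod m\<close> of the \<open>i\<close>th band complex by a scalar \<open>A\<^sub>i(p)\<close>. Compatibility with the
  differentials prescribes the quotient of the scalars at the two ends of each arrow: it is \<open>1\<close> except
  that it involves \<open>c\<close> at the letter \<open>l\<close> and \<open>\<nu>\<^sub>i\<close> at each of the \<open>n\<close> copies of the letter \<open>b i\<close>. The
  prescriptions are consistent around the cycle because \<open>c / \<nu>\<^sub>i\<^sup>n = 1\<close>, and they are solved in
  \<open>cover_weight\<close>. Since \<open>A\<^sub>i(p)\<close> loses a factor \<open>\<nu>\<^sub>i\<close> with every turn, its restriction to a
  fibre is a Vandermonde matrix up to rescaling rows and columns. Its nodes are distinct since \<open>\<omega>\<close> is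
  primitive, and its inverse is explicit by orthogonality (\<open>dft_orthogonality\<close>). This requires \<open>n\<close> to be
  invertible in the field, which already follows from the existence of a primitive \<open>n\<close>th root of
  unity (\<open>primitive_root_order_nonzero\<close>). The passage from such matrices to an isomorphism of complexes
  is \<open>power_complex_iso_by_matrices\<close>.

  An isomorphism of complexes also presupposes that both sides are complexes of modules. This
  is \<open>band_complex_is_complex\<close>: the path algebra and its quotient are rings in which scalars are
  central, and the square of the differential vanishes because two composable arrows of the diagram
  are consecutive letters of the same direction, which meet in a relation.
\<close>

section \<open>Paths and the path algebra\<close>

lemma (in pre_digraph) path_end_eq: "path_end G (x, as) = (if as = [] then x else head G (last as))"
  by (simp add: path_end_def awalk_verts_conv)

lemma (in pre_digraph) path_end_append:
  "path_end G (path_end G (x, as), bs) = path_end G (x, as @ bs)"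
  by (simp add: path_end_eq)

lemma (in wf_digraph) quiver_path_append_iff:
  "(x, as @ bs) \<in> quiver_paths G \<longleftrightarrow>
    (x, as) \<in> quiver_paths G \<and> (path_end G (x, as), bs) \<in> quiver_paths G"
  using awalk_append_iff[of x as bs]
  by (auto simp: quiver_paths_def path_start_def path_end_def awalk_append_iff)

lemma (in wf_digraph) quiver_path_start_in_verts: "(x, as) \<in> quiver_paths G \<Longrightarrow> x \<in> verts G"
  by (auto simp: quiver_paths_def path_start_def awalk_def)

lemma (in wf_digraph) trivial_quiver_path_iff: "(x, []) \<in> quiver_paths G \<longleftrightarrow> x \<in> verts G"
  by (auto simp: quiver_paths_def path_start_def path_end_def awalk_def)

lemma (in wf_digraph) quiver_path_end_in_verts: "(x, as) \<in> quiver_paths G \<Longrightarrow> path_end G (x, as) \<in> verts G"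
  using quiver_path_append_iff[of x as "[]"] trivial_quiver_path_iff by auto

lemma path_algebra_carrier_iff:
  "f \<in> carrier (path_algebra Q) \<longleftrightarrow> finite {p. f p \<noteq> 0} \<and> (\<forall>p. f p \<noteq> 0 \<longrightarrow> p \<in> quiver_paths Q)"
  by (auto simp: path_algebra_def)

lemma path_algebra_mult:
  "(f \<otimes>\<^bsub>path_algebra Q\<^esub> g) (x, as) =
    (\<Sum>i\<le>length as. f (path_end Q (x, take i as), drop i as) * g (x, take i as))"
  by (simp add: path_algebra_def)

lemma path_algebra_add: "(f \<oplus>\<^bsub>path_algebra Q\<^esub> g) p = f p + g p"
  by (simp add: path_algebra_def)

lemma path_algebra_zero: "\<zero>\<^bsub>path_algebra Q\<^esub> = (\<lambda>p. 0)"
  by (simp add: path_algebra_def)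

lemma path_algebra_one:
  "\<one>\<^bsub>path_algebra Q\<^esub> p = (if p \<in> quiver_paths Q \<and> snd p = [] then 1 else 0)"
  by (simp add: path_algebra_def)

lemma sum_eq_single_term:
  assumes "finite A" "a \<in> A" "\<And>x. x \<in> A \<Longrightarrow> x \<noteq> a \<Longrightarrow> f x = (0::'k::comm_monoid_add)"
  shows "sum f A = f a"
proof -
  have "sum f A = sum f {a}" by (rule sum.mono_neutral_right) (use assms in auto)
  then show ?thesis by simp
qed

lemma (in wf_digraph) path_algebra_mult_closed:
  assumes f: "f \<in> carrier (path_algebra G)" and g: "g \<in> carrier (path_algebra G)"
  shows "f \<otimes>\<^bsub>path_algebra G\<^esub> g \<in> carrier (path_algebra G)"
proof -
  have factor: "\<exists>q p. f q \<noteq> 0 \<and> g p \<noteq> 0 \<and> r = (fst p, snd p @ snd q) \<and> r \<in> quiver_paths G"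
    if nz: "(f \<otimes>\<^bsub>path_algebra G\<^esub> g) r \<noteq> 0" for r
  proof -
    obtain x as where r: "r = (x, as)" by (cases r)
    obtain i where i: "f (path_end G (x, take i as), drop i as) * g (x, take i as) \<noteq> 0"
      using nz unfolding r path_algebra_mult by (meson sum.not_neutral_contains_not_neutral)
    then have "(x, take i as @ drop i as) \<in> quiver_paths G"
      unfolding quiver_path_append_iff using f g by (auto simp: path_algebra_carrier_iff)
    then show ?thesis using i r
      by (intro exI[of _ "(path_end G (x, take i as), drop i as)"] exI[of _ "(x, take i as)"]) auto
  qed
  have "{r. (f \<otimes>\<^bsub>path_algebra G\<^esub> g) r \<noteq> 0} \<subseteq>
      (\<lambda>(q, p). (fst p, snd p @ snd q)) ` ({q. f q \<noteq> 0} \<times> {p. g p \<noteq> 0})"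
    using factor by fastforce
  moreover have "finite ({q. f q \<noteq> 0} \<times> {p. g p \<noteq> 0})"
    using f g by (auto simp: path_algebra_carrier_iff)
  ultimately have "finite {r. (f \<otimes>\<^bsub>path_algebra G\<^esub> g) r \<noteq> 0}"
    by (meson finite_imageI finite_subset)
  then show ?thesis using factor by (auto simp: path_algebra_carrier_iff)
qed

text \<open>Both sides sum over the ways to cut a path into three consecutive pieces.\<close>

lemma (in wf_digraph) path_algebra_mult_assoc:
  "(f \<otimes>\<^bsub>path_algebra G\<^esub> g) \<otimes>\<^bsub>path_algebra G\<^esub> h = f \<otimes>\<^bsub>path_algebra G\<^esub> (g \<otimes>\<^bsub>path_algebra G\<^esub> h)"
proof
  fix r :: "'a \<times> 'b list"
  obtain x as where r: "r = (x, as)" by (cases r)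
  define N where "N = length as"
  define F where "F i k = f (path_end G (x, take k as), drop k as)
    * g (path_end G (x, take i as), take (k - i) (drop i as)) * h (x, take i as)" for i k
  have "((f \<otimes>\<^bsub>path_algebra G\<^esub> g) \<otimes>\<^bsub>path_algebra G\<^esub> h) (x, as) = (\<Sum>i\<le>N. \<Sum>j\<le>N - i. F i (i + j))"
    unfolding path_algebra_mult sum_distrib_right
    by (intro sum.cong)
      (auto simp: N_def F_def path_end_append take_add add.commute mult.assoc)
  also have "\<dots> = (\<Sum>i\<le>N. \<Sum>k\<in>{i..N}. F i k)"
    by (intro sum.cong refl sum.reindex_bij_witness[of _ "\<lambda>k. k - i" "\<lambda>j. i + j" for i]) auto
  also have "\<dots> = (\<Sum>k\<le>N. \<Sum>i\<le>k. F i k)"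
    unfolding sum.Sigma[OF finite_atMost ballI, OF finite_atMost] sum.Sigma[OF finite_atMost ballI, OF finite_atLeastAtMost]
    by (intro sum.reindex_bij_witness[of _ "\<lambda>(k, i). (i, k)" "\<lambda>(i, k). (k, i)"]) auto
  also have "\<dots> = (f \<otimes>\<^bsub>path_algebra G\<^esub> (g \<otimes>\<^bsub>path_algebra G\<^esub> h)) (x, as)"
    unfolding path_algebra_mult sum_distrib_left
    by (intro sum.cong) (auto simp: N_def F_def min_absorb1 min_absorb2 drop_take mult.assoc)
  finally show "((f \<otimes>\<^bsub>path_algebra G\<^esub> g) \<otimes>\<^bsub>path_algebra G\<^esub> h) r = (f \<otimes>\<^bsub>path_algebra G\<^esub> (g \<otimes>\<^bsub>path_algebra G\<^esub> h)) r"
    unfolding r .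
qed

lemma (in fin_digraph) path_algebra_one_closed:
  "(\<one>\<^bsub>path_algebra G\<^esub> :: _ \<Rightarrow> 'k::field) \<in> carrier (path_algebra G)"
proof -
  have "{p. (\<one>\<^bsub>path_algebra G\<^esub> :: _ \<Rightarrow> 'k) p \<noteq> 0} \<subseteq> (\<lambda>x. (x, [])) ` verts G"
    using quiver_path_start_in_verts by (auto simp: path_algebra_one split: if_splits)
  then have "finite {p. (\<one>\<^bsub>path_algebra G\<^esub> :: _ \<Rightarrow> 'k) p \<noteq> 0}"
    by (rule finite_subset) (intro finite_imageI finite_verts)
  then show ?thesis by (auto simp: path_algebra_carrier_iff path_algebra_one)
qed

text \<open>Since \<open>1\<close> is supported on trivial paths, only the cut at one end of a path contributes to the
  product, and it does contribute because that end is a vertex of the quiver.\<close>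

lemma (in wf_digraph) path_algebra_scalar_mult:
  assumes f: "f \<in> carrier (path_algebra G)"
  shows "(\<lambda>p. c * \<one>\<^bsub>path_algebra G\<^esub> p) \<otimes>\<^bsub>path_algebra G\<^esub> f = (\<lambda>p. c * f p)"
    and "f \<otimes>\<^bsub>path_algebra G\<^esub> (\<lambda>p. c * \<one>\<^bsub>path_algebra G\<^esub> p) = (\<lambda>p. c * f p)"
proof -
  have off: "f (x, as) = 0" if "(x, as) \<notin> quiver_paths G" for x as
    using f that by (auto simp: path_algebra_carrier_iff)
  have 1: "((\<lambda>p. c * \<one>\<^bsub>path_algebra G\<^esub> p) \<otimes>\<^bsub>path_algebra G\<^esub> f) (x, as) = c * f (x, as)" for x as
  proof -
    have "((\<lambda>p. c * \<one>\<^bsub>path_algebra G\<^esub> p) \<otimes>\<^bsub>path_algebra G\<^esub> f) (x, as)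
      = c * \<one>\<^bsub>path_algebra G\<^esub> (path_end G (x, as), []) * f (x, as)"
      unfolding path_algebra_mult
      by (subst sum_eq_single_term[of _ "length as"]) (auto simp: path_algebra_one)
    then show ?thesis
      using off quiver_path_end_in_verts by (cases "(x, as) \<in> quiver_paths G")
        (auto simp: path_algebra_one trivial_quiver_path_iff)
  qed
  have 2: "(f \<otimes>\<^bsub>path_algebra G\<^esub> (\<lambda>p. c * \<one>\<^bsub>path_algebra G\<^esub> p)) (x, as) = c * f (x, as)" for x as
  proof -
    have "(f \<otimes>\<^bsub>path_algebra G\<^esub> (\<lambda>p. c * \<one>\<^bsub>path_algebra G\<^esub> p)) (x, as)
      = f (x, as) * (c * \<one>\<^bsub>path_algebra G\<^esub> (x, []))"
      unfolding path_algebra_mult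
      by (subst sum_eq_single_term[of _ 0]) (auto simp: path_algebra_one path_end_eq)
    then show ?thesis
      using off quiver_path_start_in_verts by (cases "(x, as) \<in> quiver_paths G")
        (auto simp: path_algebra_one trivial_quiver_path_iff)
  qed
  show "(\<lambda>p. c * \<one>\<^bsub>path_algebra G\<^esub> p) \<otimes>\<^bsub>path_algebra G\<^esub> f = (\<lambda>p. c * f p)"
    and "f \<otimes>\<^bsub>path_algebra G\<^esub> (\<lambda>p. c * \<one>\<^bsub>path_algebra G\<^esub> p) = (\<lambda>p. c * f p)"
    using 1 2 by (auto intro!: ext)
qed

lemma path_algebra_scale_closed:
  assumes "f \<in> carrier (path_algebra Q)"
  shows "(\<lambda>p. c * f p) \<in> carrier (path_algebra Q)"
proof -
  have "{p. c * f p \<noteq> 0} \<subseteq> {p. f p \<noteq> 0}" by auto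
  then show ?thesis using assms finite_subset by (auto simp: path_algebra_carrier_iff)
qed

lemma (in fin_digraph) path_algebra_ring:
  "ring (path_algebra G :: (_ \<Rightarrow> 'k::field) ring)"
proof (rule ringI)
  show "abelian_group (path_algebra G :: (_ \<Rightarrow> 'k) ring)"
  proof (rule abelian_groupI)
    fix f g :: "_ \<Rightarrow> 'k"
    assume f: "f \<in> carrier (path_algebra G)" and g: "g \<in> carrier (path_algebra G)"
    have "{p. f p + g p \<noteq> 0} \<subseteq> {p. f p \<noteq> 0} \<union> {p. g p \<noteq> 0}" by auto
    then have "finite {p. f p + g p \<noteq> 0}"
      using f g finite_subset by (fastforce simp: path_algebra_carrier_iff)
    then show "f \<oplus>\<^bsub>path_algebra G\<^esub> g \<in> carrier (path_algebra G)"
      using f g by (auto simp: path_algebra_carrier_iff path_algebra_add) (metis add.right_neutral)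
  next
    fix f :: "_ \<Rightarrow> 'k"
    assume f: "f \<in> carrier (path_algebra G)"
    show "\<exists>g \<in> carrier (path_algebra G). g \<oplus>\<^bsub>path_algebra G\<^esub> f = \<zero>\<^bsub>path_algebra G\<^esub>"
      using path_algebra_scale_closed[OF f, of "- 1"]
      by (rule bexI[rotated]) (auto simp: path_algebra_add path_algebra_zero)
  qed (auto simp: path_algebra_add path_algebra_zero path_algebra_carrier_iff add.assoc add.commute)
  show "monoid (path_algebra G :: (_ \<Rightarrow> 'k) ring)"
    using path_algebra_scalar_mult[where c = "1 :: 'k"]
    by (intro monoidI path_algebra_mult_closed path_algebra_one_closed path_algebra_mult_assoc) auto
next
  fix f g h :: "_ \<Rightarrow> 'k"
  show "(f \<oplus>\<^bsub>path_algebra G\<^esub> g) \<otimes>\<^bsub>path_algebra G\<^esub> h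
      = f \<otimes>\<^bsub>path_algebra G\<^esub> h \<oplus>\<^bsub>path_algebra G\<^esub> g \<otimes>\<^bsub>path_algebra G\<^esub> h"
    and "h \<otimes>\<^bsub>path_algebra G\<^esub> (f \<oplus>\<^bsub>path_algebra G\<^esub> g)
      = h \<otimes>\<^bsub>path_algebra G\<^esub> f \<oplus>\<^bsub>path_algebra G\<^esub> h \<otimes>\<^bsub>path_algebra G\<^esub> g"
    by (auto simp: path_algebra_add path_algebra_mult fun_eq_iff distrib_left distrib_right sum.distrib)
qed

lemma path_elem_closed: "p \<in> quiver_paths Q \<Longrightarrow> path_elem c p \<in> carrier (path_algebra Q)"
  by (auto simp: path_algebra_carrier_iff path_elem_def split: if_splits)

text \<open>Two paths multiply to their concatenation because a cut of the concatenation into these two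
  pieces is determined by the length of the first.\<close>

lemma path_elem_mult:
  "path_elem c (path_end Q (x, as), bs) \<otimes>\<^bsub>path_algebra Q\<^esub> path_elem d (x, as) = path_elem (c * d) (x, as @ bs)"
proof
  fix r :: "'a \<times> 'b list"
  obtain y cs where r: "r = (y, cs)" by (cases r)
  have cut: "i = length as \<and> cs = as @ bs" if "i \<le> length cs" "take i cs = as" "drop i cs = bs" for i
    using that append_take_drop_id[of i cs] by (metis length_take min.absorb2)
  have summand: "path_elem c (path_end Q (x, as), bs) (path_end Q (y, take i cs), drop i cs) * path_elem d (x, as) (y, take i cs)
      = (if i = length as then path_elem (c * d) (x, as @ bs) r else 0)" if i: "i \<le> length cs" for i
  proof (cases "(y, take i cs) = (x, as) \<and> drop i cs = bs")
    case True
    then show ?thesis using cut[OF i] r by (simp add: path_elem_def)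
  next
    case False
    then have "i = length as \<Longrightarrow> r \<noteq> (x, as @ bs)" using r cut by auto
    then show ?thesis using False by (auto simp: path_elem_def)
  qed
  have "(path_elem c (path_end Q (x, as), bs) \<otimes>\<^bsub>path_algebra Q\<^esub> path_elem d (x, as)) r
      = (if length as \<le> length cs then path_elem (c * d) (x, as @ bs) r else 0)"
    unfolding r path_algebra_mult using summand[unfolded r] by simp
  also have "\<dots> = path_elem (c * d) (x, as @ bs) r"
    using r by (auto simp: path_elem_def)
  finally show "(path_elem c (path_end Q (x, as), bs) \<otimes>\<^bsub>path_algebra Q\<^esub> path_elem d (x, as)) r
    = path_elem (c * d) (x, as @ bs) r" .
qed



section \<open>The bound algebra and its scalars\<close>

text \<open>A zero relation kills every path through it, because the path is a product with the
  relation as a factor.\<close>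

lemma (in wf_digraph) ideal_contains_path_with_subpath:
  assumes I: "ideal I (path_algebra G :: (_ \<Rightarrow> 'k::field) ring)"
    and path: "(x, as @ bs @ cs) \<in> quiver_paths G"
    and sub: "path_in (path_end G (x, as), bs) I"
  shows "path_in (x, as @ bs @ cs) I"
proof -
  interpret ideal I "path_algebra G" by fact
  have as: "(x, as) \<in> quiver_paths G" and cs: "(path_end G (x, as @ bs), cs) \<in> quiver_paths G"
    using path by (simp_all add: quiver_path_append_iff path_end_append)
  have "path_elem 1 (x, as @ bs)
      = path_elem 1 (path_end G (x, as), bs) \<otimes>\<^bsub>path_algebra G\<^esub> path_elem (1::'k) (x, as)"
    by (simp add: path_elem_mult)
  then have "path_in (x, as @ bs) I"
    using I_r_closed[OF sub path_elem_closed[OF as, of 1]] by simp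
  moreover have "path_elem 1 (x, (as @ bs) @ cs)
      = path_elem 1 (path_end G (x, as @ bs), cs) \<otimes>\<^bsub>path_algebra G\<^esub> path_elem (1::'k) (x, as @ bs)"
    by (simp only: path_elem_mult mult_1_left)
  ultimately show ?thesis
    using I_l_closed[OF _ path_elem_closed[OF cs, of 1]] by simp
qed

text \<open>Centrality makes right multiplication by a scalar preserve the left ideals \<open>\<Lambda> e\<close> and
  commute with right multiplication by a path. Matrices over the field thus act on direct sums of
  copies of a projective module.\<close>

locale central_scalars = ring R for R (structure) +
  fixes \<kappa> :: "'k::field \<Rightarrow> 'a"
  assumes scalar_closed [simp]: "\<kappa> a \<in> carrier R"
    and scalar_add: "\<kappa> (a + b) = \<kappa> a \<oplus> \<kappa> b"
    and scalar_mult: "\<kappa> (a * b) = \<kappa> a \<otimes> \<kappa> b"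
    and scalar_one: "\<kappa> 1 = \<one>"
    and scalar_central: "u \<in> carrier R \<Longrightarrow> \<kappa> a \<otimes> u = u \<otimes> \<kappa> a"
begin

lemma scalar_zero: "\<kappa> 0 = \<zero>"
proof -
  have "\<kappa> 0 \<oplus> \<kappa> 0 = \<kappa> 0" using scalar_add[of 0 0] by simp
  then show ?thesis using add.l_cancel_one' by (metis scalar_closed)
qed

lemma scalar_sum: "\<kappa> (\<Sum>i\<in>A. f i) = (\<Oplus>i\<in>A. \<kappa> (f i))"
  by (induction A rule: infinite_finite_induct)
    (auto simp: scalar_zero scalar_add Pi_def)

lemma scalar_right_comm:
  "\<lbrakk>u \<in> carrier R; v \<in> carrier R\<rbrakk> \<Longrightarrow> u \<otimes> \<kappa> a \<otimes> v = u \<otimes> v \<otimes> \<kappa> a"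
  by (metis m_assoc scalar_central scalar_closed)

end

context abelian_monoid begin

lemma finsum_group:
  assumes "finite S" "finite T" "g ` S \<subseteq> T" "\<And>s. s \<in> S \<Longrightarrow> f s \<in> carrier G"
  shows "(\<Oplus>t\<in>T. \<Oplus>s\<in>{s \<in> S. g s = t}. f s) = (\<Oplus>s\<in>S. f s)"
proof -
  have "(\<Oplus>s\<in>(\<Union>t\<in>T. {s \<in> S. g s = t}). f s) = (\<Oplus>t\<in>T. \<Oplus>s\<in>{s \<in> S. g s = t}. f s)"
    by (rule add.finprod_UN_disjoint) (use assms in \<open>auto simp: pairwise_def disjnt_def\<close>)
  moreover have "(\<Union>t\<in>T. {s \<in> S. g s = t}) = S" using assms(3) by auto
  ultimately show ?thesis by simp
qed

lemma finsum_swap: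
  assumes "finite A" "finite B" "\<And>a b. a \<in> A \<Longrightarrow> b \<in> B \<Longrightarrow> f a b \<in> carrier G"
  shows "(\<Oplus>a\<in>A. \<Oplus>b\<in>B. f a b) = (\<Oplus>b\<in>B. \<Oplus>a\<in>A. f a b)"
  using assms(1,3)
proof (induction A)
  case empty
  then show ?case by simp
next
  case (insert a A)
  then show ?case
    using assms(2) by (simp add: finsum_addf Pi_def cong: finsum_cong)
qed

end

context gentle_algebra begin

abbreviation "\<Lambda> \<equiv> bound_algebra Q I"
abbreviation "path_class p \<equiv> bound_class Q I (path_elem 1 p)"

definition scalar :: "'k \<Rightarrow> (('v, 'a) qpath \<Rightarrow> 'k) set" where
  "scalar c = bound_class Q I (\<lambda>p. c * \<one>\<^bsub>path_algebra Q\<^esub> p)"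

lemma relation_ideal: "ideal I (path_algebra Q)"
proof -
  interpret A: ring "path_algebra Q :: (('v, 'a) qpath \<Rightarrow> 'k) ring" by (rule path_algebra_ring)
  obtain S where S: "S \<subseteq> {p \<in> quiver_paths Q. length (snd p) = 2}" "I = Idl\<^bsub>path_algebra Q\<^esub> (path_elem 1 ` S)"
    using generated_by_length_2 by blast
  show ?thesis
    unfolding S(2) by (rule A.genideal_ideal) (use S(1) path_elem_closed in blast)
qed

lemma bound_class_hom: "ring_hom_ring (path_algebra Q) \<Lambda> (bound_class Q I)"
  using ideal.rcos_ring_hom_ring[OF relation_ideal] unfolding bound_algebra_def bound_class_def .

lemma path_class_closed: "p \<in> quiver_paths Q \<Longrightarrow> path_class p \<in> carrier \<Lambda>"
  using ring_hom_ring.homh[OF bound_class_hom] path_elem_closed[of p Q 1]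
  by (auto simp: ring_hom_def)

lemma path_class_mult:
  assumes "(x, as @ bs) \<in> quiver_paths Q"
  shows "path_class (path_end Q (x, as), bs) \<otimes>\<^bsub>\<Lambda>\<^esub> path_class (x, as) = path_class (x, as @ bs)"
proof -
  have "(path_end Q (x, as), bs) \<in> quiver_paths Q" "(x, as) \<in> quiver_paths Q"
    using assms by (simp_all add: quiver_path_append_iff)
  then have "bound_class Q I (path_elem 1 (path_end Q (x, as), bs) \<otimes>\<^bsub>path_algebra Q\<^esub> path_elem 1 (x, as))
    = path_class (path_end Q (x, as), bs) \<otimes>\<^bsub>\<Lambda>\<^esub> path_class (x, as)"
    by (intro ring_hom_mult[OF ring_hom_ring.homh[OF bound_class_hom]] path_elem_closed)
  then show ?thesis by (simp add: path_elem_mult)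
qed

lemma path_class_zero: "path_in p I \<Longrightarrow> path_class p = \<zero>\<^bsub>\<Lambda>\<^esub>"
  using abelian_subgroup.a_rcos_const[OF ideal.axioms(1)[OF relation_ideal, THEN abelian_subgroupI3]]
    ring.is_abelian_group[OF path_algebra_ring]
  by (simp add: bound_class_def bound_algebra_def FactRing_def)

sublocale central_scalars \<Lambda> scalar
proof -
  interpret A: ring "path_algebra Q :: (('v, 'a) qpath \<Rightarrow> 'k) ring" by (rule path_algebra_ring)
  interpret h: ring_hom_ring "path_algebra Q :: (('v, 'a) qpath \<Rightarrow> 'k) ring" \<Lambda> "bound_class Q I"
    by (rule bound_class_hom)
  have closed: "(\<lambda>p. c * \<one>\<^bsub>path_algebra Q\<^esub> p) \<in> carrier (path_algebra Q)" for c :: 'k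
    by (rule path_algebra_scale_closed) (rule path_algebra_one_closed)
  show "central_scalars \<Lambda> scalar"
  proof
    fix a b :: 'k
    show "scalar a \<in> carrier \<Lambda>" unfolding scalar_def by (rule h.hom_closed[OF closed])
    have "(\<lambda>p. (a + b) * \<one>\<^bsub>path_algebra Q\<^esub> p)
        = (\<lambda>p. a * \<one>\<^bsub>path_algebra Q\<^esub> p) \<oplus>\<^bsub>path_algebra Q\<^esub> (\<lambda>p. b * \<one>\<^bsub>path_algebra Q\<^esub> p)"
      by (auto simp: path_algebra_add distrib_right)
    then show "scalar (a + b) = scalar a \<oplus>\<^bsub>\<Lambda>\<^esub> scalar b"
      unfolding scalar_def using h.hom_add[OF closed closed] by simp
    have "(\<lambda>p. (a * b) * \<one>\<^bsub>path_algebra Q\<^esub> p)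
        = (\<lambda>p. a * \<one>\<^bsub>path_algebra Q\<^esub> p) \<otimes>\<^bsub>path_algebra Q\<^esub> (\<lambda>p. b * \<one>\<^bsub>path_algebra Q\<^esub> p)"
      using path_algebra_scalar_mult(1)[OF closed] by (simp add: mult.assoc)
    then show "scalar (a * b) = scalar a \<otimes>\<^bsub>\<Lambda>\<^esub> scalar b"
      unfolding scalar_def using h.hom_mult[OF closed closed] by simp
    show "scalar 1 = \<one>\<^bsub>\<Lambda>\<^esub>" unfolding scalar_def using h.hom_one by simp
    fix u assume "u \<in> carrier \<Lambda>"
    then obtain f where f: "f \<in> carrier (path_algebra Q)" and u: "u = bound_class Q I f"
      by (auto simp: bound_algebra_def bound_class_def FactRing_def A_RCOSETS_def RCOSETS_def a_r_coset_def)
    show "scalar a \<otimes>\<^bsub>\<Lambda>\<^esub> u = u \<otimes>\<^bsub>\<Lambda>\<^esub> scalar a"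
      unfolding scalar_def u h.hom_mult[OF closed f, symmetric] h.hom_mult[OF f closed, symmetric]
        path_algebra_scalar_mult[OF f] ..
  qed
qed

text \<open>This splits the parameter of a band complex off from the letter that carries it.\<close>

lemma bound_class_path_elem:
  assumes "p \<in> quiver_paths Q"
  shows "bound_class Q I (path_elem c p) = path_class p \<otimes>\<^bsub>\<Lambda>\<^esub> scalar c"
proof -
  interpret h: ring_hom_ring "path_algebra Q :: (('v, 'a) qpath \<Rightarrow> 'k) ring" \<Lambda> "bound_class Q I"
    by (rule bound_class_hom)
  have p: "path_elem 1 p \<in> carrier (path_algebra Q)" using assms by (rule path_elem_closed)
  have closed: "(\<lambda>p. c * \<one>\<^bsub>path_algebra Q\<^esub> p) \<in> carrier (path_algebra Q)"
    by (rule path_algebra_scale_closed) (rule path_algebra_one_closed)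
  have "path_elem c p = path_elem 1 p \<otimes>\<^bsub>path_algebra Q\<^esub> (\<lambda>p. c * \<one>\<^bsub>path_algebra Q\<^esub> p)"
    unfolding path_algebra_scalar_mult[OF p] by (auto simp: path_elem_def)
  then show ?thesis unfolding scalar_def h.hom_mult[OF p closed, symmetric] by simp
qed

end



section \<open>Projective modules and direct sums\<close>

lemma module_dsum_carrier: "carrier (module_dsum A M) = (\<Pi>\<^sub>E i\<in>A. carrier (M i))"
  by (simp add: module_dsum_def)

lemma module_dsum_add: "i \<in> A \<Longrightarrow> (f \<oplus>\<^bsub>module_dsum A M\<^esub> g) i = f i \<oplus>\<^bsub>M i\<^esub> g i"
  by (simp add: module_dsum_def)

lemma module_dsum_smult: "i \<in> A \<Longrightarrow> (a \<odot>\<^bsub>module_dsum A M\<^esub> f) i = a \<odot>\<^bsub>M i\<^esub> f i"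
  by (simp add: module_dsum_def)

lemma left_module_dsum:
  assumes R: "ring R" and M: "\<And>i. i \<in> A \<Longrightarrow> left_module R (M i)"
  shows "left_module R (module_dsum A M)"
proof -
  interpret R: ring R by fact
  have grp: "abelian_group (M i)" if "i \<in> A" for i
    using M[OF that] by (simp add: left_module_def)
  have neg: "\<exists>g\<in>\<Pi>\<^sub>E i\<in>A. carrier (M i). (\<lambda>i\<in>A. g i \<oplus>\<^bsub>M i\<^esub> f i) = (\<lambda>i\<in>A. \<zero>\<^bsub>M i\<^esub>)"
    if "f \<in> (\<Pi>\<^sub>E i\<in>A. carrier (M i))" for f
    using that abelian_groupE(6)[OF grp]
    by (intro bexI[of _ "\<lambda>i\<in>A. \<ominus>\<^bsub>M i\<^esub> f i"])
      (auto intro!: restrict_ext PiE_I abelian_group.a_inv_closed abelian_group.l_neg grp)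
  have "abelian_group (module_dsum A M)"
    using neg
    by (intro abelian_groupI)
      (auto simp: module_dsum_def fun_eq_iff PiE_iff extensional_def
        abelian_groupE(1,2,3,5)[OF grp] intro: abelian_groupE(4)[OF grp])
  moreover have "left_module_axioms R (module_dsum A M)"
    by standard
      (auto simp: module_dsum_def fun_eq_iff PiE_iff extensional_def left_module.smult_one[OF M]
        intro!: left_module.smult_closed[OF M] left_module.smult_l_distr[OF M]
        left_module.smult_r_distr[OF M] left_module.smult_assoc[OF M])
  ultimately show ?thesis by (intro left_module.intro R)
qed

context gentle_algebra begin

abbreviation "proj x \<equiv> carrier (proj_module Q I x)"

lemma trivial_path_class_closed: "x \<in> verts Q \<Longrightarrow> path_class (x, []) \<in> carrier \<Lambda>"
  by (rule path_class_closed) (simp add: trivial_quiver_path_iff)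

text \<open>The trivial path at \<open>x\<close> is idempotent, so \<open>\<Lambda> e\<^sub>x\<close> consists of the elements fixed by it. In
  this form, closure under sums, scalars and composition with paths is immediate.\<close>

lemma proj_iff:
  assumes x: "x \<in> verts Q"
  shows "u \<in> proj x \<longleftrightarrow> u \<in> carrier \<Lambda> \<and> u \<otimes>\<^bsub>\<Lambda>\<^esub> path_class (x, []) = u"
proof -
  have e: "path_class (x, []) \<in> carrier \<Lambda>" by (rule trivial_path_class_closed[OF x])
  have "path_class (x, []) \<otimes>\<^bsub>\<Lambda>\<^esub> path_class (x, []) = path_class (x, [])"
    using path_class_mult[of x "[]" "[]"] x by (simp add: trivial_quiver_path_iff path_end_eq)
  then have "v \<otimes>\<^bsub>\<Lambda>\<^esub> path_class (x, []) \<otimes>\<^bsub>\<Lambda>\<^esub> path_class (x, []) = v \<otimes>\<^bsub>\<Lambda>\<^esub> path_class (x, [])"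
    if "v \<in> carrier \<Lambda>" for v
    using that e by (simp add: m_assoc)
  then show ?thesis
    using e by (auto simp: proj_module_def image_iff)
qed

lemma proj_module_simps:
  "\<zero>\<^bsub>proj_module Q I x\<^esub> = \<zero>\<^bsub>\<Lambda>\<^esub>"
  "u \<oplus>\<^bsub>proj_module Q I x\<^esub> v = u \<oplus>\<^bsub>\<Lambda>\<^esub> v"
  "a \<odot>\<^bsub>proj_module Q I x\<^esub> u = a \<otimes>\<^bsub>\<Lambda>\<^esub> u"
  by (simp_all add: proj_module_def)

lemma proj_finsum_closed:
  assumes x: "x \<in> verts Q" and u: "\<And>i. i \<in> A \<Longrightarrow> u i \<in> proj x"
  shows "(\<Oplus>\<^bsub>\<Lambda>\<^esub>i\<in>A. u i) \<in> proj x"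
proof (cases "finite A")
  case True
  have "(\<Oplus>\<^bsub>\<Lambda>\<^esub>i\<in>A. u i) \<otimes>\<^bsub>\<Lambda>\<^esub> path_class (x, []) = (\<Oplus>\<^bsub>\<Lambda>\<^esub>i\<in>A. u i \<otimes>\<^bsub>\<Lambda>\<^esub> path_class (x, []))"
    by (rule finsum_ldistr) (use True x u in \<open>auto simp: proj_iff trivial_path_class_closed\<close>)
  also have "\<dots> = (\<Oplus>\<^bsub>\<Lambda>\<^esub>i\<in>A. u i)"
    by (rule finsum_cong') (use x u in \<open>auto simp: proj_iff\<close>)
  finally show ?thesis
    using x u by (auto simp: proj_iff intro!: finsum_closed)
next
  case False
  then show ?thesis
    using x by (auto simp: proj_iff finsum_infinite trivial_path_class_closed)
qed

lemma proj_scalar_closed: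
  "\<lbrakk>x \<in> verts Q; u \<in> proj x\<rbrakk> \<Longrightarrow> u \<otimes>\<^bsub>\<Lambda>\<^esub> scalar a \<in> proj x"
  using scalar_right_comm[of u "path_class (x, [])"] by (auto simp: proj_iff trivial_path_class_closed)

lemma proj_path_closed:
  assumes p: "p \<in> quiver_paths Q" and u: "u \<in> carrier \<Lambda>"
  shows "u \<otimes>\<^bsub>\<Lambda>\<^esub> path_class p \<in> proj (path_start p)"
proof -
  obtain x as where p': "p = (x, as)" by (cases p)
  have x: "x \<in> verts Q" using p quiver_path_start_in_verts unfolding p' by blast
  have "path_class (x, as) \<otimes>\<^bsub>\<Lambda>\<^esub> path_class (x, []) = path_class (x, as)"
    using path_class_mult[of x "[]" as] p by (simp add: p' path_end_eq)
  then have "u \<otimes>\<^bsub>\<Lambda>\<^esub> path_class (x, as) \<otimes>\<^bsub>\<Lambda>\<^esub> path_class (x, []) = u \<otimes>\<^bsub>\<Lambda>\<^esub> path_class (x, as)"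
    using path_class_closed[OF p] trivial_path_class_closed[OF x] u by (simp add: m_assoc p')
  then show ?thesis
    using x u path_class_closed[OF p] by (simp add: proj_iff p' path_start_def)
qed

lemma proj_left_module:
  assumes x: "x \<in> verts Q"
  shows "left_module \<Lambda> (proj_module Q I x)"
proof (intro left_module.intro)
  show "ring \<Lambda>" by (rule ring_axioms)
  have e: "path_class (x, []) \<in> carrier \<Lambda>" by (rule trivial_path_class_closed[OF x])
  show "abelian_group (proj_module Q I x)"
  proof (rule abelian_groupI, goal_cases)
    case (6 u)
    then show ?case
      using e x by (intro bexI[of _ "\<ominus>\<^bsub>\<Lambda>\<^esub> u"]) (auto simp: proj_iff proj_module_simps l_minus l_neg)
  next
    case (4 u v)
    then show ?case using x by (simp add: proj_iff proj_module_simps a_comm)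
  qed (use e x in \<open>simp_all add: proj_iff proj_module_simps l_distr a_assoc\<close>)
  show "left_module_axioms \<Lambda> (proj_module Q I x)"
    by standard (use e x in \<open>auto simp: proj_iff proj_module_simps m_assoc l_distr r_distr\<close>)
qed

end



section \<open>Cyclic words\<close>

lemma word_power_length: "length (word_power w n) = n * length w"
  by (induction n) (auto simp: word_power_def)

lemma word_power_nth: "p < n * length w \<Longrightarrow> word_power w n ! p = w ! (p mod length w)"
proof (induction n arbitrary: p)
  case (Suc n)
  then show ?case
    by (cases "p < length w") (auto simp: word_power_def nth_append le_mod_geq)
qed simp

text \<open>The part of the definition of a band that makes its cyclic diagram carry a complex: the string
  conditions hold across the seam as well, and the degrees agree there. Proper powers of bands are
  not bands, but they still have these properties.\<close>

definition cyclic_word ::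
  "('v, 'a) pre_digraph \<Rightarrow> (('v, 'a) qpath \<Rightarrow> 'k::field) set \<Rightarrow> ('v, 'a) letter list \<Rightarrow> bool" where
  "cyclic_word Q I w \<longleftrightarrow> w \<noteq> [] \<and> vertex_degree 0 w (length w) = 0 \<and>
    (\<forall>j<length w. homotopy_letter Q I (w ! j) \<and>
      letter_start Q (w ! (Suc j mod length w)) = letter_end Q (w ! j) \<and>
      junction Q I (w ! j) (w ! (Suc j mod length w)))"

lemma total_degree:
  "(\<Sum>j<length w. if is_direct (w ! j) then - 1 else 1 :: int)
    = int (length (filter (\<lambda>l. \<not> is_direct l) w)) - int (length (filter is_direct w))"
  by (induction w rule: rev_induct) (auto simp: nth_append intro!: sum.cong)

text \<open>The seam of the cyclic diagram is the junction in the middle of the word \<open>w w\<close>.\<close>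

lemma homotopy_band_cyclic_word:
  assumes "homotopy_band Q I w"
  shows "cyclic_word Q I w"
proof -
  have w: "w \<noteq> []" and string: "homotopy_string Q I (w @ w)"
    and bal: "length (filter is_direct w) = length (filter (\<lambda>l. \<not> is_direct l) w)"
    using assms by (auto simp: homotopy_band_def word_power_def numeral_2_eq_2)
  have "letter_start Q (w ! (Suc j mod length w)) = letter_end Q (w ! j) \<and>
      junction Q I (w ! j) (w ! (Suc j mod length w))" if j: "j < length w" for j
  proof -
    have "Suc j < length (w @ w)" using j by simp
    then have "letter_start Q ((w @ w) ! Suc j) = letter_end Q ((w @ w) ! j)
        \<and> junction Q I ((w @ w) ! j) ((w @ w) ! Suc j)"
      using string by (simp add: homotopy_string_def successively_conv_nth)
    moreover have "(w @ w) ! Suc j = w ! (Suc j mod length w)"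
      using j by (cases "Suc j = length w") (auto simp: nth_append)
    ultimately show ?thesis using j by (simp add: nth_append)
  qed
  then show ?thesis
    using w string bal total_degree[of w]
    by (auto simp: cyclic_word_def vertex_degree_def homotopy_string_def)
qed

text \<open>Going once around the diagram does not change the degree, so the diagram of a power covers
  that of the word by a map that preserves degrees.\<close>

lemma vertex_degree_periodic:
  assumes w: "w \<noteq> []" and cyc: "vertex_degree 0 w (length w) = 0" and p: "p \<le> n * length w"
  shows "vertex_degree d (word_power w n) p = vertex_degree d w (p mod length w)"
  using p
proof (induction p)
  case 0
  then show ?case by (simp add: vertex_degree_def)
next
  case (Suc p)
  define m where "m = length w"
  have m: "m > 0" using w by (simp add: m_def)
  have "vertex_degree d (word_power w n) (Suc p)
      = vertex_degree d w (p mod m) + (if is_direct (w ! (p mod m)) then - 1 else 1)"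
    using Suc by (simp add: vertex_degree_def word_power_nth m_def)
  also have "\<dots> = vertex_degree d w (Suc (p mod m))"
    by (simp add: vertex_degree_def)
  also have "\<dots> = vertex_degree d w (Suc p mod m)"
  proof (cases "Suc (p mod m) = m")
    case True
    then have "Suc p mod m = 0" by (metis mod_Suc)
    then show ?thesis using True cyc by (simp add: vertex_degree_def m_def)
  next
    case False
    then show ?thesis by (simp add: mod_Suc)
  qed
  finally show ?case by (simp add: m_def)
qed

lemma Suc_mod_power_length:
  fixes n m :: nat shows "Suc p mod (n * m) mod m = Suc (p mod m) mod m"
  by (simp add: mod_mod_cancel mod_Suc_eq)

lemma cyclic_word_power:
  assumes w: "cyclic_word Q I w" and n: "n \<ge> 1"
  shows "cyclic_word Q I (word_power w n)"
proof -
  have ne: "w \<noteq> []" using w by (simp add: cyclic_word_def)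
  then have pos: "n * length w > 0" "length w > 0" using n by auto
  have "vertex_degree 0 (word_power w n) (n * length w) = 0"
    using vertex_degree_periodic[of w "n * length w" n 0] w by (simp add: cyclic_word_def vertex_degree_def)
  moreover have "word_power w n \<noteq> []"
    using pos by (metis length_0_conv less_irrefl word_power_length)
  moreover have "word_power w n ! (Suc p mod (n * length w)) = w ! (Suc (p mod length w) mod length w)" for p
    using word_power_nth[of "Suc p mod (n * length w)" n w] pos by (simp add: Suc_mod_power_length)
  ultimately show ?thesis
    using w pos by (simp add: cyclic_word_def word_power_length word_power_nth)
qed

lemma Suc_mod_inj:
  fixes i j m :: nat
  assumes "i < m" "j < m" "Suc i mod m = Suc j mod m"
  shows "i = j"
  using assms by (auto simp: mod_Suc split: if_splits)

lemma Suc_mod_surj: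
  fixes p m :: nat
  assumes "p < m"
  obtains j where "j < m" "Suc j mod m = p"
  using assms that[of "m - 1"] that[of "p - 1"] by (cases p) auto

lemma arrow_bounds:
  assumes "w \<noteq> []" "j < length w"
  shows "arrow_source w j < length w" "arrow_target w j < length w"
  using assms by (auto simp: arrow_source_def arrow_target_def)

lemma arrow_degree:
  assumes w: "cyclic_word Q I w" and j: "j < length w"
  shows "vertex_degree d w (arrow_target w j) = vertex_degree d w (arrow_source w j) + 1"
proof -
  have "vertex_degree d w (Suc j mod length w) = vertex_degree d w (Suc j)"
    using w j by (cases "Suc j = length w") (auto simp: cyclic_word_def vertex_degree_def)
  also have "\<dots> = vertex_degree d w j + (if is_direct (w ! j) then - 1 else 1)"
    by (simp add: vertex_degree_def)
  finally show ?thesis by (simp add: arrow_source_def arrow_target_def)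
qed



section \<open>Roots of unity\<close>

text \<open>The hypothesis on \<open>i\<close> and \<open>j\<close> is on their difference because the exponents occurring below
  range over \<open>{1..n}\<close> as well as \<open>{..<n}\<close>.\<close>

lemma primitive_root_power_neq:
  fixes \<omega> :: "'k::field"
  assumes \<omega>: "primitive_root_of_unity n \<omega>" and ij: "i < j" "j < i + n"
  shows "\<omega> ^ i \<noteq> \<omega> ^ j"
proof
  assume eq: "\<omega> ^ i = \<omega> ^ j"
  have "\<omega> \<noteq> 0" using \<omega> by (auto simp: primitive_root_of_unity_def power_0_left)
  moreover have "\<omega> ^ j = \<omega> ^ i * \<omega> ^ (j - i)" using ij by (simp flip: power_add)
  ultimately have "\<omega> ^ (j - i) = 1" using eq by simp
  then show False using \<omega> ij by (auto simp: primitive_root_of_unity_def)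
qed

lemma sum_powers_of_root_of_unity:
  fixes \<zeta> :: "'k::field"
  assumes "\<zeta> ^ n = 1"
  shows "(\<Sum>k<n. \<zeta> ^ k) = (if \<zeta> = 1 then of_nat n else 0)"
  using assms by (simp add: sum_gp_strict)

text \<open>If \<open>n = 0\<close> in the field, then \<open>1\<close> and the other powers of \<open>\<omega>\<close> would be \<open>n\<close> distinct roots
  of \<open>1 + x + \<dots> + x\<^sup>n\<^sup>-\<^sup>1\<close>.\<close>

lemma primitive_root_order_nonzero:
  fixes \<omega> :: "'k::field"
  assumes \<omega>: "primitive_root_of_unity n \<omega>"
  shows "(of_nat n :: 'k) \<noteq> 0"
proof
  assume n0: "(of_nat n :: 'k) = 0"
  have n: "n > 0" "\<omega> ^ n = 1" using \<omega> by (auto simp: primitive_root_of_unity_def)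
  define q :: "'k poly" where "q = (\<Sum>k<n. monom 1 k)"
  have "coeff q 0 = 1" using n by (simp add: q_def coeff_sum coeff_monom)
  then have q: "q \<noteq> 0" by auto
  have deg: "degree q \<le> n - 1"
    unfolding q_def by (intro degree_sum_le) (auto intro: order_trans[OF degree_monom_le])
  have "poly q (\<omega> ^ i) = 0" for i
  proof -
    have "(\<omega> ^ i) ^ n = 1" using n by (metis mult.commute power_mult power_one)
    then have "(\<Sum>k<n. (\<omega> ^ i) ^ k) = 0"
      using n0 by (subst sum_powers_of_root_of_unity) auto
    then show ?thesis by (simp add: q_def poly_sum poly_monom)
  qed
  then have "(\<lambda>i. \<omega> ^ i) ` {..<n} \<subseteq> {x. poly q x = 0}" by auto
  then have "card ((\<lambda>i. \<omega> ^ i) ` {..<n}) \<le> card {x. poly q x = 0}"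
    by (intro card_mono poly_roots_finite q)
  moreover have "inj_on (\<lambda>i. \<omega> ^ i) {..<n}"
    by (rule inj_onI) (metis \<omega> primitive_root_power_neq lessThan_iff nat_neq_iff trans_less_add2)
  ultimately have "n \<le> card {x. poly q x = 0}" by (simp add: card_image)
  also have "\<dots> \<le> n - 1" using card_poly_roots_bound[OF q] deg by linarith
  finally show False using n by simp
qed

text \<open>The rows and the columns of the Vandermonde matrix with nodes \<open>\<omega>\<^sup>i \<mu>\<close> are orthogonal in the
  sense of the discrete Fourier transform; this gives the inverse of the matrix explicitly.\<close>

lemma dft_orthogonality:
  fixes \<omega> \<mu> :: "'k::field" and n :: nat
  defines "\<nu> \<equiv> \<lambda>i. \<omega> ^ i * \<mu>"
  assumes \<omega>: "primitive_root_of_unity n \<omega>" and \<mu>: "\<mu> \<noteq> 0"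
  shows "\<lbrakk>i \<in> {1..n}; j \<in> {1..n}\<rbrakk> \<Longrightarrow> (\<Sum>k<n. \<nu> j ^ k / \<nu> i ^ k) = (if i = j then of_nat n else 0)"
    and "\<lbrakk>h < n; k < n\<rbrakk> \<Longrightarrow> (\<Sum>i\<in>{1..n}. \<nu> i ^ k / \<nu> i ^ h) = (if h = k then of_nat n else 0)"
proof -
  have n: "\<omega> ^ n = 1" and \<omega>0: "\<omega> \<noteq> 0"
    using \<omega> by (auto simp: primitive_root_of_unity_def power_0_left)
  have root: "(\<omega> ^ j / \<omega> ^ i) ^ n = 1" for i j
    using n by (metis div_by_1 mult.commute power_divide power_mult power_one)
  have inj: "\<omega> ^ j / \<omega> ^ i = 1 \<longleftrightarrow> i = j" if "i < j + n" "j < i + n" for i j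
    using that primitive_root_power_neq[OF \<omega>, of i j] primitive_root_power_neq[OF \<omega>, of j i] \<omega>0
    by (cases i j rule: linorder_cases) auto
  show "(\<Sum>k<n. \<nu> j ^ k / \<nu> i ^ k) = (if i = j then of_nat n else 0)"
    if "i \<in> {1..n}" "j \<in> {1..n}"
  proof -
    have "(\<Sum>k<n. \<nu> j ^ k / \<nu> i ^ k) = (\<Sum>k<n. (\<omega> ^ j / \<omega> ^ i) ^ k)"
      using \<mu> by (intro sum.cong) (auto simp: \<nu>_def power_divide power_mult_distrib)
    then show ?thesis
      using sum_powers_of_root_of_unity[OF root, of j i] inj[of i j] that by simp
  qed
  show "(\<Sum>i\<in>{1..n}. \<nu> i ^ k / \<nu> i ^ h) = (if h = k then of_nat n else 0)"
    if "h < n" "k < n"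
  proof -
    let ?\<zeta> = "\<omega> ^ k / \<omega> ^ h"
    have "(\<Sum>i\<in>{1..n}. \<nu> i ^ k / \<nu> i ^ h) = (\<Sum>i\<in>{1..n}. \<mu> ^ k / \<mu> ^ h * ?\<zeta> ^ i)"
      by (intro sum.cong) (auto simp: \<nu>_def power_divide power_mult_distrib mult.commute simp flip: power_mult)
    also have "\<dots> = (\<Sum>i<n. \<mu> ^ k / \<mu> ^ h * ?\<zeta> ^ Suc i)"
      by (rule sum.reindex_bij_witness[of _ Suc "\<lambda>i. i - 1"]) auto
    also have "\<dots> = \<mu> ^ k / \<mu> ^ h * ?\<zeta> * (\<Sum>i<n. ?\<zeta> ^ i)"
      by (simp add: sum_distrib_left mult.assoc)
    finally show ?thesis
      using sum_powers_of_root_of_unity[OF root, of k h] inj[of h k] that \<mu> \<omega>0 by auto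
  qed
qed



section \<open>Band complexes\<close>

context gentle_algebra begin

abbreviation "arrow w j \<equiv> path_class (letter_path (w ! j))"

lemma letter_path_in_quiver_paths:
  "\<lbrakk>cyclic_word Q I w; j < length w\<rbrakk> \<Longrightarrow> letter_path (w ! j) \<in> quiver_paths Q"
  by (simp add: cyclic_word_def homotopy_letter_def)

lemma letter_path_ends:
  assumes "cyclic_word Q I w" "j < length w"
  shows "path_start (letter_path (w ! j)) = letter_start Q (w ! arrow_target w j)"
    and "path_end Q (letter_path (w ! j)) = letter_start Q (w ! arrow_source w j)"
  using assms by (cases "w ! j"; auto simp: cyclic_word_def arrow_source_def arrow_target_def)+

lemma letter_start_in_verts:
  assumes "cyclic_word Q I w" "j < length w"
  shows "letter_start Q (w ! j) \<in> verts Q"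
proof (cases "w ! j")
  case (Direct p)
  then show ?thesis
    using letter_path_in_quiver_paths[OF assms] quiver_path_start_in_verts[of "fst p" "snd p"]
    by (simp add: path_start_def)
next
  case (Inverse p)
  then show ?thesis
    using letter_path_in_quiver_paths[OF assms] quiver_path_end_in_verts[of "fst p" "snd p"] by simp
qed

text \<open>The two arrows in the relation are adjacent in the concatenated path.\<close>

lemma composable_relation_zero:
  assumes p: "p \<in> quiver_paths Q" "snd p \<noteq> []" and q: "q \<in> quiver_paths Q" "snd q \<noteq> []"
    and comp: "path_start q = path_end Q p"
    and rel: "path_in (path_of_arrows Q [last (snd p), hd (snd q)]) I"
  shows "path_class q \<otimes>\<^bsub>\<Lambda>\<^esub> path_class p = \<zero>\<^bsub>\<Lambda>\<^esub>"
proof -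
  obtain x as a where p': "p = (x, as @ [a])"
    using p(2) by (metis prod.collapse rev_exhaust)
  obtain a' bs where q': "q = (path_end Q p, a' # bs)"
    using q(2) comp by (metis list.exhaust prod.collapse path_start_def)
  have path: "(x, (as @ [a]) @ a' # bs) \<in> quiver_paths Q"
    using quiver_path_append_iff[of x "as @ [a]" "a' # bs"] p q p' q' by simp
  have "(path_end Q (x, as), [a]) \<in> quiver_paths Q"
    using p p' by (simp add: quiver_path_append_iff)
  then have "path_end Q (x, as) = tail Q a"
    by (simp add: quiver_paths_def path_start_def awalk_def)
  then have "path_in (path_end Q (x, as), [a, a']) I"
    using rel by (simp add: p' q' path_of_arrows_def)
  then have "path_in (x, (as @ [a]) @ a' # bs) I"
    using ideal_contains_path_with_subpath[OF relation_ideal, of x as "[a, a']" bs] path by simp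
  then have "path_class (x, (as @ [a]) @ a' # bs) = \<zero>\<^bsub>\<Lambda>\<^esub>" by (rule path_class_zero)
  then show ?thesis
    using path_class_mult[OF path] p' q' by simp
qed

text \<open>Two arrows of the diagram that can be composed are consecutive letters with the same
  direction, so the junction condition puts a relation where they meet.\<close>

lemma consecutive_arrows_zero:
  assumes w: "cyclic_word Q I w" and j: "j < length w" "j' < length w"
    and comp: "arrow_target w j' = arrow_source w j"
  shows "arrow w j' \<otimes>\<^bsub>\<Lambda>\<^esub> arrow w j = \<zero>\<^bsub>\<Lambda>\<^esub>"
proof (rule composable_relation_zero)
  show "letter_path (w ! j) \<in> quiver_paths Q" "letter_path (w ! j') \<in> quiver_paths Q"
    using letter_path_in_quiver_paths[OF w] j by auto
  show "snd (letter_path (w ! j)) \<noteq> []" "snd (letter_path (w ! j')) \<noteq> []"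
    using w j by (simp_all add: cyclic_word_def homotopy_letter_def)
  show "path_start (letter_path (w ! j')) = path_end Q (letter_path (w ! j))"
    using letter_path_ends[OF w] j comp by simp
  note succ_inj = Suc_mod_inj[OF j]
  have junction: "junction Q I (w ! i) (w ! (Suc i mod length w))" if "i < length w" for i
    using w that by (simp add: cyclic_word_def)
  show "path_in (path_of_arrows Q [last (snd (letter_path (w ! j))), hd (snd (letter_path (w ! j')))]) I"
  proof (cases "w ! j")
    case (Direct p)
    then have "Suc j mod length w = arrow_target w j'"
      using comp by (simp add: arrow_source_def)
    then have "is_direct (w ! j') \<and> Suc j mod length w = j'"
      using succ_inj Direct by (auto simp: arrow_target_def split: if_splits)
    then show ?thesis
      using junction[OF j(1)] Direct by (cases "w ! j'") auto
  next
    case (Inverse p)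
    then have "arrow_target w j' = j" using comp by (simp add: arrow_source_def)
    then have "\<not> is_direct (w ! j') \<and> Suc j' mod length w = j"
      using Inverse by (auto simp: arrow_target_def split: if_splits)
    then show ?thesis
      using junction[OF j(2)] Inverse by (cases "w ! j'") auto
  qed
qed

lemma arrow_closed: "\<lbrakk>cyclic_word Q I w; j < length w\<rbrakk> \<Longrightarrow> arrow w j \<in> carrier \<Lambda>"
  by (intro path_class_closed letter_path_in_quiver_paths)

lemma mult_arrow_in_proj:
  assumes "cyclic_word Q I w" "j < length w" "u \<in> carrier \<Lambda>"
  shows "u \<otimes>\<^bsub>\<Lambda>\<^esub> arrow w j \<in> proj (letter_start Q (w ! arrow_target w j))"
  using proj_path_closed[OF letter_path_in_quiver_paths[OF assms(1,2)] assms(3)]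
    letter_path_ends[OF assms(1,2)] by simp

lemma vertices_of_degreeD: "v \<in> vertices_of_degree d w i \<Longrightarrow> v < length w"
  by (simp add: vertices_of_degree_def)

lemma arrow_source_of_degree:
  assumes "cyclic_word Q I w" "j < length w" "arrow_target w j \<in> vertices_of_degree d w (i + 1)"
  shows "arrow_source w j \<in> vertices_of_degree d w i"
  using assms arrow_degree[OF assms(1,2), of d] arrow_bounds[of w j]
  by (auto simp: vertices_of_degree_def cyclic_word_def)

lemma band_obj: "obj (band_complex Q I d w b c) i
    = module_dsum (vertices_of_degree d w i) (\<lambda>v. proj_module Q I (letter_start Q (w ! v)))"
  by (simp add: band_complex_def)

lemma band_obj_carrier: "carrier (obj (band_complex Q I d w b c) i)
    = (\<Pi>\<^sub>E v\<in>vertices_of_degree d w i. proj (letter_start Q (w ! v)))"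
  by (simp add: band_obj module_dsum_carrier)

lemma band_obj_component_closed:
  assumes "cyclic_word Q I w" "f \<in> carrier (obj (band_complex Q I d w b c) i)"
    "v \<in> vertices_of_degree d w i"
  shows "f v \<in> carrier \<Lambda>"
  using assms letter_start_in_verts[OF assms(1) vertices_of_degreeD[OF assms(3)]]
  by (auto simp: band_obj_carrier PiE_iff proj_iff)

lemma band_diff:
  assumes w: "cyclic_word Q I w" and f: "f \<in> carrier (obj (band_complex Q I d w b c) i)"
    and v: "v \<in> vertices_of_degree d w (i + 1)"
  shows "diff (band_complex Q I d w b c) i f v =
    (\<Oplus>\<^bsub>\<Lambda>\<^esub>j\<in>{j. j < length w \<and> arrow_target w j = v}.
      f (arrow_source w j) \<otimes>\<^bsub>\<Lambda>\<^esub> arrow w j \<otimes>\<^bsub>\<Lambda>\<^esub> scalar (if j = b then c else 1))"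
proof -
  have closed: "f (arrow_source w j) \<in> carrier \<Lambda>" if "j < length w" "arrow_target w j = v" for j
    using band_obj_component_closed[OF w f] arrow_source_of_degree[OF w] that v by blast
  have "diff (band_complex Q I d w b c) i f v =
    (\<Oplus>\<^bsub>\<Lambda>\<^esub>j\<in>{j. j < length w \<and> arrow_target w j = v}.
      f (arrow_source w j) \<otimes>\<^bsub>\<Lambda>\<^esub> bound_class Q I (path_elem (if j = b then c else 1) (letter_path (w ! j))))"
    using v by (simp add: band_complex_def)
  also have "\<dots> = (\<Oplus>\<^bsub>\<Lambda>\<^esub>j\<in>{j. j < length w \<and> arrow_target w j = v}.
      f (arrow_source w j) \<otimes>\<^bsub>\<Lambda>\<^esub> arrow w j \<otimes>\<^bsub>\<Lambda>\<^esub> scalar (if j = b then c else 1))"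
    using closed arrow_closed[OF w] letter_path_in_quiver_paths[OF w]
    by (intro finsum_cong') (auto simp: bound_class_path_elem[of _ "if _ then _ else _"] m_assoc)
  finally show ?thesis .
qed

lemma band_obj_left_module:
  assumes "cyclic_word Q I w"
  shows "left_module \<Lambda> (obj (band_complex Q I d w b c) i)"
  unfolding band_obj
  by (intro left_module_dsum ring_axioms proj_left_module letter_start_in_verts[OF assms])
    (rule vertices_of_degreeD)

lemma band_obj_add:
  "v \<in> vertices_of_degree d w i \<Longrightarrow>
    (f \<oplus>\<^bsub>obj (band_complex Q I d w b c) i\<^esub> g) v = f v \<oplus>\<^bsub>\<Lambda>\<^esub> g v"
  by (simp add: band_obj module_dsum_add proj_module_simps)

lemma band_obj_smult:
  "v \<in> vertices_of_degree d w i \<Longrightarrow>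
    (a \<odot>\<^bsub>obj (band_complex Q I d w b c) i\<^esub> f) v = a \<otimes>\<^bsub>\<Lambda>\<^esub> f v"
  by (simp add: band_obj module_dsum_smult proj_module_simps)

lemma band_diff_closed:
  assumes w: "cyclic_word Q I w" and f: "f \<in> carrier (obj (band_complex Q I d w b c) i)"
  shows "diff (band_complex Q I d w b c) i f \<in> carrier (obj (band_complex Q I d w b c) (i + 1))"
  unfolding band_obj_carrier
proof (rule PiE_I)
  fix v assume v: "v \<in> vertices_of_degree d w (i + 1)"
  then have x: "letter_start Q (w ! v) \<in> verts Q"
    using letter_start_in_verts[OF w] vertices_of_degreeD by blast
  have "f (arrow_source w j) \<otimes>\<^bsub>\<Lambda>\<^esub> arrow w j \<otimes>\<^bsub>\<Lambda>\<^esub> scalar a \<in> proj (letter_start Q (w ! v))"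
    if "j < length w" "arrow_target w j = v" for j a
    using mult_arrow_in_proj[OF w that(1)] that x v arrow_source_of_degree[OF w]
      band_obj_component_closed[OF w f] by (auto intro!: proj_scalar_closed)
  then show "diff (band_complex Q I d w b c) i f v \<in> proj (letter_start Q (w ! v))"
    unfolding band_diff[OF w f v] by (intro proj_finsum_closed[OF x]) auto
qed (simp add: band_complex_def)

lemma band_diff_lin_hom:
  fixes b c d
  assumes w: "cyclic_word Q I w"
  defines "C \<equiv> band_complex Q I d w b c"
  shows "diff C i \<in> lin_hom \<Lambda> (obj C i) (obj C (i + 1))"
proof -
  have closed: "f (arrow_source w j) \<in> carrier \<Lambda>"
    if "f \<in> carrier (obj C i)" "arrow_target w j \<in> vertices_of_degree d w (i + 1)" "j < length w" for f j
    using that band_obj_component_closed[OF w] arrow_source_of_degree[OF w] unfolding C_def by blast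
  note arrows = arrow_closed[OF w] arrow_source_of_degree[OF w]
  define T where "T v = {j. j < length w \<and> arrow_target w j = v}" for v
  define F where "F f j = f (arrow_source w j) \<otimes>\<^bsub>\<Lambda>\<^esub> arrow w j \<otimes>\<^bsub>\<Lambda>\<^esub> scalar (if j = b then c else 1)" for f j
  have F_closed: "F f \<in> T v \<rightarrow> carrier \<Lambda>"
    if "f \<in> carrier (obj C i)" "v \<in> vertices_of_degree d w (i + 1)" for f v
    using closed[OF that(1)] that(2) arrows by (auto simp: F_def T_def)
  have diff: "diff C i f v = (\<Oplus>\<^bsub>\<Lambda>\<^esub>j\<in>T v. F f j)"
    if "f \<in> carrier (obj C i)" "v \<in> vertices_of_degree d w (i + 1)" for f v
    using band_diff[OF w, of f d b c i v] that unfolding C_def F_def T_def by simp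
  have fin: "finite (T v)" for v by (simp add: T_def)
  interpret M: left_module \<Lambda> "obj C i" unfolding C_def by (rule band_obj_left_module[OF w])
  interpret N: left_module \<Lambda> "obj C (i + 1)" unfolding C_def by (rule band_obj_left_module[OF w])
  have into: "diff C i f \<in> carrier (obj C (i + 1))" if "f \<in> carrier (obj C i)" for f
    using band_diff_closed[OF w] that unfolding C_def by blast
  have ext: "f = g" if "f \<in> carrier (obj C (i + 1))" "g \<in> carrier (obj C (i + 1))"
    "\<And>v. v \<in> vertices_of_degree d w (i + 1) \<Longrightarrow> f v = g v" for f g
    using that unfolding C_def band_obj_carrier by (intro PiE_ext) auto
  have "diff C i (f \<oplus>\<^bsub>obj C i\<^esub> g) = diff C i f \<oplus>\<^bsub>obj C (i + 1)\<^esub> diff C i g"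
    if f: "f \<in> carrier (obj C i)" and g: "g \<in> carrier (obj C i)" for f g
  proof (rule ext)
    fix v assume v: "v \<in> vertices_of_degree d w (i + 1)"
    have "diff C i (f \<oplus>\<^bsub>obj C i\<^esub> g) v = (\<Oplus>\<^bsub>\<Lambda>\<^esub>j\<in>T v. F f j \<oplus>\<^bsub>\<Lambda>\<^esub> F g j)"
      unfolding diff[OF M.add.m_closed[OF f g] v]
    proof (rule finsum_cong')
      fix j assume "j \<in> T v"
      then show "F (f \<oplus>\<^bsub>obj C i\<^esub> g) j = F f j \<oplus>\<^bsub>\<Lambda>\<^esub> F g j"
        using closed[OF f] closed[OF g] v arrows
        by (simp add: F_def T_def C_def band_obj_add l_distr)
    qed (use F_closed[OF f v] F_closed[OF g v] in auto)
    also have "\<dots> = diff C i f v \<oplus>\<^bsub>\<Lambda>\<^esub> diff C i g v"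
      unfolding diff[OF f v] diff[OF g v] by (rule finsum_addf[OF F_closed[OF f v] F_closed[OF g v]])
    also have "\<dots> = (diff C i f \<oplus>\<^bsub>obj C (i + 1)\<^esub> diff C i g) v"
      unfolding C_def band_obj_add[OF v] ..
    finally show "diff C i (f \<oplus>\<^bsub>obj C i\<^esub> g) v = (diff C i f \<oplus>\<^bsub>obj C (i + 1)\<^esub> diff C i g) v" .
  qed (use f g into in auto)
  moreover have "diff C i (a \<odot>\<^bsub>obj C i\<^esub> f) = a \<odot>\<^bsub>obj C (i + 1)\<^esub> diff C i f"
    if a: "a \<in> carrier \<Lambda>" and f: "f \<in> carrier (obj C i)" for a f
  proof (rule ext)
    fix v assume v: "v \<in> vertices_of_degree d w (i + 1)"
    have "diff C i (a \<odot>\<^bsub>obj C i\<^esub> f) v = (\<Oplus>\<^bsub>\<Lambda>\<^esub>j\<in>T v. a \<otimes>\<^bsub>\<Lambda>\<^esub> F f j)"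
      unfolding diff[OF M.smult_closed[OF a f] v]
    proof (rule finsum_cong')
      fix j assume "j \<in> T v"
      then show "F (a \<odot>\<^bsub>obj C i\<^esub> f) j = a \<otimes>\<^bsub>\<Lambda>\<^esub> F f j"
        using closed[OF f] v arrows a by (simp add: F_def T_def C_def band_obj_smult m_assoc)
    qed (use F_closed[OF f v] a in auto)
    also have "\<dots> = a \<otimes>\<^bsub>\<Lambda>\<^esub> diff C i f v"
      unfolding diff[OF f v] by (rule finsum_rdistr[OF fin a F_closed[OF f v], symmetric])
    also have "\<dots> = (a \<odot>\<^bsub>obj C (i + 1)\<^esub> diff C i f) v"
      unfolding C_def band_obj_smult[OF v] ..
    finally show "diff C i (a \<odot>\<^bsub>obj C i\<^esub> f) v = (a \<odot>\<^bsub>obj C (i + 1)\<^esub> diff C i f) v" .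
  qed (use a f into in \<open>auto intro: M.smult_closed N.smult_closed\<close>)
  ultimately show ?thesis using into by (auto simp: lin_hom_def)
qed

text \<open>Every term in a component of the squared differential runs along two composable arrows of the
  diagram.\<close>

lemma band_complex_is_complex:
  assumes w: "cyclic_word Q I w"
  shows "cochain_complex \<Lambda> (band_complex Q I d w b c)"
proof -
  define C where "C = band_complex Q I d w b c"
  have "diff C (i + 1) (diff C i f) = \<zero>\<^bsub>obj C (i + 2)\<^esub>" if f: "f \<in> carrier (obj C i)" for i f
  proof -
    have df: "diff C i f \<in> carrier (obj C (i + 1))"
      using band_diff_closed[OF w] f unfolding C_def by blast
    have ddf: "diff C (i + 1) (diff C i f) \<in> carrier (obj C (i + 2))"
      using band_diff_closed[OF w df[unfolded C_def]] unfolding C_def by (simp add: add.assoc)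
    have zero: "diff C (i + 1) (diff C i f) v = \<zero>\<^bsub>\<Lambda>\<^esub>" if v: "v \<in> vertices_of_degree d w (i + 1 + 1)" for v
    proof -
      have "diff C i f (arrow_source w j) \<otimes>\<^bsub>\<Lambda>\<^esub> arrow w j = \<zero>\<^bsub>\<Lambda>\<^esub>"
        if j: "j < length w" "arrow_target w j = v" for j
      proof -
        have v': "arrow_source w j \<in> vertices_of_degree d w (i + 1)"
          using arrow_source_of_degree[OF w] j v by blast
        have closed: "f (arrow_source w j') \<in> carrier \<Lambda>"
          if "j' < length w" "arrow_target w j' = arrow_source w j" for j'
          using that v' band_obj_component_closed[OF w f[unfolded C_def]] arrow_source_of_degree[OF w]
          by metis
        have "f (arrow_source w j') \<otimes>\<^bsub>\<Lambda>\<^esub> arrow w j' \<otimes>\<^bsub>\<Lambda>\<^esub> scalar a \<otimes>\<^bsub>\<Lambda>\<^esub> arrow w j = \<zero>\<^bsub>\<Lambda>\<^esub>"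
          if "j' < length w" "arrow_target w j' = arrow_source w j" for j' a
          using closed[OF that] arrow_closed[OF w that(1)] arrow_closed[OF w j(1)]
            consecutive_arrows_zero[OF w j(1) that]
          by (subst scalar_right_comm) (simp_all add: m_assoc)
        then show ?thesis
          unfolding C_def band_diff[OF w f[unfolded C_def] v']
          using closed arrow_closed[OF w] j
          by (subst finsum_ldistr) (auto intro!: add.finprod_one_eqI)
      qed
      then show ?thesis
        unfolding C_def band_diff[OF w df[unfolded C_def] v]
        by (intro add.finprod_one_eqI) (auto simp: C_def)
    qed
    show ?thesis
      using ddf zero unfolding C_def band_obj_carrier
      by (auto simp: band_obj module_dsum_def proj_module_simps PiE_iff extensional_def fun_eq_iff add.assoc)
  qed
  then show ?thesis
    using band_diff_lin_hom[OF w] band_obj_left_module[OF w]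
    by (simp add: cochain_complex_def C_def)
qed

end



section \<open>Complexes of a power of a word\<close>

lemma cochain_dsum_complex:
  assumes R: "ring R" and C: "\<And>i. i \<in> X \<Longrightarrow> cochain_complex R (C i)"
  shows "cochain_complex R (cochain_dsum X C)"
proof -
  have mod: "left_module R (obj (C i) k)"
    and lin: "diff (C i) k \<in> lin_hom R (obj (C i) k) (obj (C i) (k + 1))"
    and zero: "x \<in> carrier (obj (C i) k) \<Longrightarrow> diff (C i) (k + 1) (diff (C i) k x) = \<zero>\<^bsub>obj (C i) (k + 2)\<^esub>"
    if "i \<in> X" for i k x
    using C[OF that] by (auto simp: cochain_complex_def)
  have "diff (cochain_dsum X C) k \<in> lin_hom R (obj (cochain_dsum X C) k) (obj (cochain_dsum X C) (k + 1))" for k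
    using lin by (auto simp: lin_hom_def cochain_dsum_def module_dsum_def PiE_iff Pi_iff fun_eq_iff)
  moreover have "left_module R (obj (cochain_dsum X C) k)" for k
    by (simp add: cochain_dsum_def left_module_dsum[OF R mod])
  moreover have "diff (cochain_dsum X C) (k + 1) (diff (cochain_dsum X C) k x) = \<zero>\<^bsub>obj (cochain_dsum X C) (k + 2)\<^esub>"
    if "x \<in> carrier (obj (cochain_dsum X C) k)" for k x
    using that zero by (auto simp: cochain_dsum_def module_dsum_def PiE_iff fun_eq_iff)
  ultimately show ?thesis by (simp add: cochain_complex_def)
qed

text \<open>Applying two scalar matrices in turn to a vector with entries in the ring amounts to applying
  their product. It is stated for one entry \<open>p\<close> of the result, where only one row of the product
  matters.\<close>

lemma (in central_scalars) scalar_matrix_inverse: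
  assumes fin: "finite P" "finite X" and p: "p \<in> P"
    and u: "\<And>q. q \<in> P \<Longrightarrow> u q \<in> carrier R"
    and inv: "\<And>q. q \<in> P \<Longrightarrow> (\<Sum>i\<in>X. a i q * b i) = (if p = q then 1 else 0)"
  shows "(\<Oplus>i\<in>X. (\<Oplus>q\<in>P. u q \<otimes> \<kappa> (a i q)) \<otimes> \<kappa> (b i)) = u p"
proof -
  have "(\<Oplus>i\<in>X. (\<Oplus>q\<in>P. u q \<otimes> \<kappa> (a i q)) \<otimes> \<kappa> (b i)) = (\<Oplus>i\<in>X. \<Oplus>q\<in>P. u q \<otimes> \<kappa> (a i q * b i))"
  proof (rule finsum_cong')
    fix i
    have "(\<Oplus>q\<in>P. u q \<otimes> \<kappa> (a i q)) \<otimes> \<kappa> (b i) = (\<Oplus>q\<in>P. u q \<otimes> \<kappa> (a i q) \<otimes> \<kappa> (b i))"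
      by (rule finsum_ldistr) (use fin u in auto)
    also have "\<dots> = (\<Oplus>q\<in>P. u q \<otimes> \<kappa> (a i q * b i))"
      by (rule finsum_cong') (use u in \<open>auto simp: scalar_mult m_assoc\<close>)
    finally show "(\<Oplus>q\<in>P. u q \<otimes> \<kappa> (a i q)) \<otimes> \<kappa> (b i) = (\<Oplus>q\<in>P. u q \<otimes> \<kappa> (a i q * b i))" .
  qed (use u in \<open>auto intro!: finsum_closed\<close>)
  also have "\<dots> = (\<Oplus>q\<in>P. \<Oplus>i\<in>X. u q \<otimes> \<kappa> (a i q * b i))"
    by (rule finsum_swap) (use fin u in auto)
  also have "\<dots> = (\<Oplus>q\<in>P. if p = q then u q else \<zero>)"
  proof (rule finsum_cong')
    fix q assume q: "q \<in> P"
    have "(\<Oplus>i\<in>X. u q \<otimes> \<kappa> (a i q * b i)) = u q \<otimes> \<kappa> (\<Sum>i\<in>X. a i q * b i)"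
      unfolding scalar_sum by (rule finsum_rdistr[symmetric]) (use fin u q in auto)
    then show "(\<Oplus>i\<in>X. u q \<otimes> \<kappa> (a i q * b i)) = (if p = q then u q else \<zero>)"
      using inv[OF q] u[OF q] by (simp add: scalar_one scalar_zero)
  qed (use u in auto)
  also have "\<dots> = u p" by (rule add.finprod_singleton) (use p fin u in auto)
  finally show ?thesis .
qed

lemma (in central_scalars) scalar_slide:
  assumes "u \<in> carrier R" "v \<in> carrier R"
  shows "u \<otimes> \<kappa> a \<otimes> (v \<otimes> \<kappa> b) = u \<otimes> v \<otimes> \<kappa> (a * b)"
  using assms scalar_right_comm[of u v a]
  by (simp add: scalar_mult flip: m_assoc)

lemma arrow_ends_power:
  assumes w: "w \<noteq> []" and j: "j < n * length w"
  shows "arrow_source (word_power w n) j mod length w = arrow_source w (j mod length w)"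
    and "arrow_target (word_power w n) j mod length w = arrow_target w (j mod length w)"
  using assms
  by (auto simp: arrow_source_def arrow_target_def word_power_length word_power_nth Suc_mod_power_length)

text \<open>Above a fixed arrow of the diagram of \<open>w\<close>, each preimage of its source is the source of
  exactly one arrow of the \<open>n\<close>-fold cover.\<close>

lemma arrow_source_power_bij:
  assumes w: "w \<noteq> []" and j: "j < length w"
  shows "bij_betw (arrow_source (word_power w n))
    {p. p < n * length w \<and> p mod length w = j} {p. p < n * length w \<and> p mod length w = arrow_source w j}"
proof (cases "is_direct (w ! j)")
  case False
  then show ?thesis
    by (intro bij_betwI')
      (auto simp: arrow_source_def word_power_nth)
next
  case True
  have pos: "length w > 0" using w by simp
  have src: "arrow_source (word_power w n) p = Suc p mod (n * length w)"
    if "p < n * length w" "p mod length w = j" for p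
    using that True by (simp add: arrow_source_def word_power_nth word_power_length)
  have tgt: "arrow_source w j = Suc j mod length w" using True by (simp add: arrow_source_def)
  show ?thesis
  proof (rule bij_betwI')
    fix p q assume "p \<in> {p. p < n * length w \<and> p mod length w = j}" "q \<in> {p. p < n * length w \<and> p mod length w = j}"
    then show "(arrow_source (word_power w n) p = arrow_source (word_power w n) q) = (p = q)"
      using src Suc_mod_inj[of p "n * length w" q] by auto
  next
    fix p assume p: "p \<in> {p. p < n * length w \<and> p mod length w = j}"
    then have "p < n * length w" by simp
    then have "0 < n * length w" by (rule le_less_trans[OF le0])
    then have "Suc p mod (n * length w) < n * length w" by (rule mod_less_divisor)
    then show "arrow_source (word_power w n) p \<in> {p. p < n * length w \<and> p mod length w = arrow_source w j}"
      using p src Suc_mod_power_length[of p n "length w"] unfolding tgt by auto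
  next
    fix q assume q: "q \<in> {p. p < n * length w \<and> p mod length w = arrow_source w j}"
    then obtain p where p: "p < n * length w" "Suc p mod (n * length w) = q"
      using Suc_mod_surj by blast
    have "Suc (p mod length w) mod length w = Suc j mod length w"
      using q p Suc_mod_power_length[of p n "length w"] unfolding tgt by auto
    then have "p mod length w = j" using Suc_mod_inj[of "p mod length w" "length w" j] pos j by simp
    then show "\<exists>p\<in>{p. p < n * length w \<and> p mod length w = j}. q = arrow_source (word_power w n) p"
      using p src by auto
  qed
qed

context gentle_algebra begin

text \<open>
  The \<open>n\<close> vertices of the diagram of \<open>w\<^sup>n\<close> above a vertex \<open>v\<close> of the diagram of \<open>w\<close> carry the same
  projective module in the same degree as \<open>v\<close>. An isomorphism to a direct sum of complexes of \<open>w\<close> can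
  therefore be sought among the maps that send the summand at \<open>p\<close> to the summand at \<open>p mod m\<close> of the
  \<open>i\<close>th complex by a scalar \<open>A i p\<close>. Such a map respects the differentials if, for every arrow of
  the diagram of \<open>w\<^sup>n\<close>, following it and then applying the matrix gives the same scalar as applying
  the matrix and then following the arrow below; this is \<open>compat\<close>. The matrices \<open>A\<close> and \<open>N\<close> are
  block diagonal with one block for each \<open>v\<close>, and \<open>inv1\<close> and \<open>inv2\<close> say that they are inverse to
  each other.
\<close>

lemma power_complex_iso_by_matrices:
  fixes A N :: "nat \<Rightarrow> nat \<Rightarrow> 'k" and X :: "nat set" and w :: "('v, 'a) letter list"
    and n l :: nat and b :: "nat \<Rightarrow> nat" and c :: 'k and e :: "nat \<Rightarrow> 'k" and d :: int
  defines "m \<equiv> length w"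
  defines "\<sigma> \<equiv> word_power w n"
  assumes w: "cyclic_word Q I w" and n: "n \<ge> 1" and X: "finite X"
    and compat: "\<And>i j. \<lbrakk>i \<in> X; j < n * m\<rbrakk> \<Longrightarrow>
      A i (arrow_target \<sigma> j) * (if j = l then c else 1)
        = A i (arrow_source \<sigma> j) * (if j mod m = b i then e i else 1)"
    and inv1: "\<And>i i' v. \<lbrakk>i \<in> X; i' \<in> X; v < m\<rbrakk> \<Longrightarrow>
      (\<Sum>p | p < n * m \<and> p mod m = v. N p i' * A i p) = (if i = i' then 1 else 0)"
    and inv2: "\<And>p q. \<lbrakk>p < n * m; q < n * m; p mod m = q mod m\<rbrakk> \<Longrightarrow>
      (\<Sum>i\<in>X. A i q * N p i) = (if p = q then 1 else 0)"
  shows "cochain_isomorphic \<Lambda> (band_complex Q I d \<sigma> l c)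
    (cochain_dsum X (\<lambda>i. band_complex Q I d w (b i) (e i)))"
proof -
  define B where "B = band_complex Q I d \<sigma> l c"
  define C where "C i = band_complex Q I d w (b i) (e i)" for i
  \<comment> \<open>the fibre of the covering above \<open>v\<close>\<close>
  define S where "S v = {p. p < n * m \<and> p mod m = v}" for v
  define Vw where "Vw = vertices_of_degree d w"
  define Vs where "Vs = vertices_of_degree d \<sigma>"
  define \<phi> where "\<phi> k f = (\<lambda>i\<in>X. \<lambda>v\<in>Vw k. \<Oplus>\<^bsub>\<Lambda>\<^esub>p\<in>S v. f p \<otimes>\<^bsub>\<Lambda>\<^esub> scalar (A i p))" for k f
  define \<psi> where "\<psi> k g = (\<lambda>p\<in>Vs k. \<Oplus>\<^bsub>\<Lambda>\<^esub>i\<in>X. g i (p mod m) \<otimes>\<^bsub>\<Lambda>\<^esub> scalar (N p i))"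
    for k and g :: "nat \<Rightarrow> nat \<Rightarrow> (('v, 'a) qpath \<Rightarrow> 'k) set"
  have w0: "w \<noteq> []" and m: "m > 0" using w by (auto simp: cyclic_word_def m_def)
  have \<sigma>: "cyclic_word Q I \<sigma>" unfolding \<sigma>_def by (rule cyclic_word_power[OF w n])
  have len: "length \<sigma> = n * m" by (simp add: \<sigma>_def m_def word_power_length)
  have nth: "\<sigma> ! p = w ! (p mod m)" if "p < n * m" for p
    using that by (simp add: \<sigma>_def m_def word_power_nth)
  have Vs: "p \<in> Vs k \<longleftrightarrow> p < n * m \<and> p mod m \<in> Vw k" for p k
  proof (cases "p < n * m")
    case True
    then have "vertex_degree d \<sigma> p = vertex_degree d w (p mod m)"
      using vertex_degree_periodic[OF w0, of p n d] w by (simp add: \<sigma>_def m_def cyclic_word_def)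
    then show ?thesis using True m by (simp add: Vs_def Vw_def vertices_of_degree_def len flip: m_def)
  qed (simp add: Vs_def vertices_of_degree_def len)
  have Vw_less: "v < m" if "v \<in> Vw k" for v k
    using that vertices_of_degreeD unfolding Vw_def m_def by blast
  have x_verts: "letter_start Q (w ! v) \<in> verts Q" if "v \<in> Vw k" for v k
    using letter_start_in_verts[OF w] Vw_less[OF that] by (simp add: m_def)
  have S_fin: "finite (S v)" for v by (simp add: S_def)
  have S_Vs: "S v \<subseteq> Vs k" if "v \<in> Vw k" for v k using that by (auto simp: S_def Vs)
  have B_carrier: "carrier (obj B k) = (\<Pi>\<^sub>E p\<in>Vs k. proj (letter_start Q (w ! (p mod m))))" for k
    unfolding B_def band_obj_carrier using nth by (auto simp: Vs Vs_def[symmetric] intro!: PiE_cong)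
  have D_carrier: "carrier (obj (cochain_dsum X C) k)
      = (\<Pi>\<^sub>E i\<in>X. \<Pi>\<^sub>E v\<in>Vw k. proj (letter_start Q (w ! v)))" for k
    by (simp add: cochain_dsum_def module_dsum_carrier C_def band_obj Vw_def)
  have B_in: "f p \<in> proj (letter_start Q (w ! (p mod m)))" "f p \<in> carrier \<Lambda>"
    if "f \<in> carrier (obj B k)" "p \<in> Vs k" for f k p
  proof -
    show "f p \<in> proj (letter_start Q (w ! (p mod m)))" using that by (auto simp: B_carrier PiE_iff)
    moreover have "letter_start Q (w ! (p mod m)) \<in> verts Q" using x_verts Vs that by blast
    ultimately show "f p \<in> carrier \<Lambda>" by (simp add: proj_iff)
  qed
  have B_in_fibre: "f p \<in> carrier \<Lambda>" if "f \<in> carrier (obj B k)" "v \<in> Vw k" "p \<in> S v" for f k v p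
    using B_in(2)[OF that(1)] S_Vs[OF that(2)] that(3) by blast
  have D_in: "g i v \<in> proj (letter_start Q (w ! v))" "g i v \<in> carrier \<Lambda>"
    if "g \<in> carrier (obj (cochain_dsum X C) k)" "i \<in> X" "v \<in> Vw k" for g i k v
    using that x_verts by (auto simp: D_carrier PiE_iff proj_iff)
  have B_ext: "f = f'" if "f \<in> carrier (obj B k)" "f' \<in> carrier (obj B k)"
    "\<And>p. p \<in> Vs k \<Longrightarrow> f p = f' p" for f f' k
    using that unfolding B_carrier by (intro PiE_ext) auto
  have D_ext: "g = g'" if g: "g \<in> carrier (obj (cochain_dsum X C) k)" "g' \<in> carrier (obj (cochain_dsum X C) k)"
    and eq: "\<And>i v. i \<in> X \<Longrightarrow> v \<in> Vw k \<Longrightarrow> g i v = g' i v" for g g' k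
  proof (rule PiE_ext[OF g[unfolded D_carrier]])
    fix i assume i: "i \<in> X"
    show "g i = g' i"
      using PiE_mem[OF g(1)[unfolded D_carrier] i] PiE_mem[OF g(2)[unfolded D_carrier] i] eq[OF i]
      by (rule PiE_ext)
  qed
  have B_cplx: "cochain_complex \<Lambda> B" unfolding B_def by (rule band_complex_is_complex[OF \<sigma>])
  have C_cplx: "cochain_complex \<Lambda> (C i)" for i unfolding C_def by (rule band_complex_is_complex[OF w])
  have D_cplx: "cochain_complex \<Lambda> (cochain_dsum X C)"
    by (rule cochain_dsum_complex[OF ring_axioms C_cplx])
  have B_mod: "left_module \<Lambda> (obj B k)" and D_mod: "left_module \<Lambda> (obj (cochain_dsum X C) k)" for k
    using B_cplx D_cplx by (auto simp: cochain_complex_def)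
  have \<phi>_eq: "\<phi> k f i v = (\<Oplus>\<^bsub>\<Lambda>\<^esub>p\<in>S v. f p \<otimes>\<^bsub>\<Lambda>\<^esub> scalar (A i p))" if "i \<in> X" "v \<in> Vw k" for k f i v
    using that by (simp add: \<phi>_def)
  have \<psi>_eq: "\<psi> k g p = (\<Oplus>\<^bsub>\<Lambda>\<^esub>i\<in>X. g i (p mod m) \<otimes>\<^bsub>\<Lambda>\<^esub> scalar (N p i))" if "p \<in> Vs k" for k g p
    using that by (simp add: \<psi>_def)
  have \<phi>_into: "\<phi> k f \<in> carrier (obj (cochain_dsum X C) k)" if f: "f \<in> carrier (obj B k)" for k f
  proof -
    have "f p \<otimes>\<^bsub>\<Lambda>\<^esub> scalar (A i p) \<in> proj (letter_start Q (w ! v))" if "v \<in> Vw k" "p \<in> S v" for i v p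
      using B_in(1)[OF f, of p] S_Vs that x_verts by (intro proj_scalar_closed) (auto simp: S_def)
    then show ?thesis
      using x_verts by (auto simp: D_carrier \<phi>_def intro!: proj_finsum_closed)
  qed
  have \<psi>_into: "\<psi> k g \<in> carrier (obj B k)" if g: "g \<in> carrier (obj (cochain_dsum X C) k)" for k g
    using D_in(1)[OF g] x_verts Vs
    by (auto simp: B_carrier \<psi>_def intro!: proj_finsum_closed proj_scalar_closed)
  have \<psi>\<phi>: "\<psi> k (\<phi> k f) = f" if f: "f \<in> carrier (obj B k)" for k f
  proof (rule B_ext[OF \<psi>_into[OF \<phi>_into[OF f]] f])
    fix p assume p: "p \<in> Vs k"
    then have v: "p mod m \<in> Vw k" and pS: "p \<in> S (p mod m)" by (auto simp: Vs S_def)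
    have "\<psi> k (\<phi> k f) p = (\<Oplus>\<^bsub>\<Lambda>\<^esub>i\<in>X. \<phi> k f i (p mod m) \<otimes>\<^bsub>\<Lambda>\<^esub> scalar (N p i))" by (rule \<psi>_eq[OF p])
    also have "\<dots> = (\<Oplus>\<^bsub>\<Lambda>\<^esub>i\<in>X. (\<Oplus>\<^bsub>\<Lambda>\<^esub>q\<in>S (p mod m). f q \<otimes>\<^bsub>\<Lambda>\<^esub> scalar (A i q)) \<otimes>\<^bsub>\<Lambda>\<^esub> scalar (N p i))"
      using B_in_fibre[OF f v] by (intro finsum_cong') (auto simp: \<phi>_eq[OF _ v] intro!: m_closed finsum_closed)
    also have "\<dots> = f p"
      by (rule scalar_matrix_inverse[OF S_fin X pS])
        (use B_in_fibre[OF f v] inv2 p in \<open>auto simp: S_def Vs\<close>)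
    finally show "\<psi> k (\<phi> k f) p = f p" .
  qed
  have \<phi>\<psi>: "\<phi> k (\<psi> k g) = g" if g: "g \<in> carrier (obj (cochain_dsum X C) k)" for k g
  proof (rule D_ext[OF \<phi>_into[OF \<psi>_into[OF g]] g])
    fix i v assume i: "i \<in> X" and v: "v \<in> Vw k"
    have "\<phi> k (\<psi> k g) i v = (\<Oplus>\<^bsub>\<Lambda>\<^esub>p\<in>S v. \<psi> k g p \<otimes>\<^bsub>\<Lambda>\<^esub> scalar (A i p))" by (rule \<phi>_eq[OF i v])
    also have "\<dots> = (\<Oplus>\<^bsub>\<Lambda>\<^esub>p\<in>S v. (\<Oplus>\<^bsub>\<Lambda>\<^esub>i'\<in>X. g i' v \<otimes>\<^bsub>\<Lambda>\<^esub> scalar (N p i')) \<otimes>\<^bsub>\<Lambda>\<^esub> scalar (A i p))"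
    proof (rule finsum_cong')
      fix p assume "p \<in> S v"
      then have "p \<in> Vs k" "p mod m = v" using S_Vs[OF v] by (auto simp: S_def)
      then show "\<psi> k g p \<otimes>\<^bsub>\<Lambda>\<^esub> scalar (A i p)
          = (\<Oplus>\<^bsub>\<Lambda>\<^esub>i'\<in>X. g i' v \<otimes>\<^bsub>\<Lambda>\<^esub> scalar (N p i')) \<otimes>\<^bsub>\<Lambda>\<^esub> scalar (A i p)"
        by (simp add: \<psi>_eq)
    qed (use D_in(2)[OF g _ v] in \<open>auto intro!: m_closed finsum_closed\<close>)
    also have "\<dots> = g i v"
      by (rule scalar_matrix_inverse[OF X S_fin i])
        (use D_in(2)[OF g _ v] inv1[OF i _ Vw_less[OF v]] in \<open>auto simp: S_def\<close>)
    finally show "\<phi> k (\<psi> k g) i v = g i v" .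
  qed
  have bij: "bij_betw (\<phi> k) (carrier (obj B k)) (carrier (obj (cochain_dsum X C) k))" for k
    by (rule bij_betw_byWitness[of _ "\<psi> k"]) (use \<psi>\<phi> \<phi>\<psi> \<phi>_into \<psi>_into in auto)
  have lin: "\<phi> k \<in> lin_hom \<Lambda> (obj B k) (obj (cochain_dsum X C) k)" for k
  proof -
    interpret M: left_module \<Lambda> "obj B k" by (rule B_mod)
    interpret N: left_module \<Lambda> "obj (cochain_dsum X C) k" by (rule D_mod)
    have D_add: "(g \<oplus>\<^bsub>obj (cochain_dsum X C) k\<^esub> g') i v = g i v \<oplus>\<^bsub>\<Lambda>\<^esub> g' i v"
      and D_smult: "(a \<odot>\<^bsub>obj (cochain_dsum X C) k\<^esub> g) i v = a \<otimes>\<^bsub>\<Lambda>\<^esub> g i v"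
      if "i \<in> X" "v \<in> Vw k" for g g' a i v
      using that band_obj_add[of v d w k] band_obj_smult[of v d w k]
      by (simp_all add: cochain_dsum_def module_dsum_add module_dsum_smult C_def Vw_def)
    have B_add: "(f \<oplus>\<^bsub>obj B k\<^esub> f') p = f p \<oplus>\<^bsub>\<Lambda>\<^esub> f' p"
      and B_smult: "(a \<odot>\<^bsub>obj B k\<^esub> f) p = a \<otimes>\<^bsub>\<Lambda>\<^esub> f p" if "p \<in> Vs k" for f f' a p
      using that band_obj_add[of p d \<sigma> k] band_obj_smult[of p d \<sigma> k] by (simp_all add: B_def Vs_def)
    have "\<phi> k (f \<oplus>\<^bsub>obj B k\<^esub> f') = \<phi> k f \<oplus>\<^bsub>obj (cochain_dsum X C) k\<^esub> \<phi> k f'"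
      if f: "f \<in> carrier (obj B k)" "f' \<in> carrier (obj B k)" for f f'
    proof (rule D_ext)
      fix i v assume i: "i \<in> X" and v: "v \<in> Vw k"
      have "\<phi> k (f \<oplus>\<^bsub>obj B k\<^esub> f') i v
          = (\<Oplus>\<^bsub>\<Lambda>\<^esub>p\<in>S v. f p \<otimes>\<^bsub>\<Lambda>\<^esub> scalar (A i p) \<oplus>\<^bsub>\<Lambda>\<^esub> f' p \<otimes>\<^bsub>\<Lambda>\<^esub> scalar (A i p))"
        unfolding \<phi>_eq[OF i v]
      proof (rule finsum_cong')
        fix p assume "p \<in> S v"
        then have "p \<in> Vs k" using S_Vs[OF v] by auto
        then show "(f \<oplus>\<^bsub>obj B k\<^esub> f') p \<otimes>\<^bsub>\<Lambda>\<^esub> scalar (A i p)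
            = f p \<otimes>\<^bsub>\<Lambda>\<^esub> scalar (A i p) \<oplus>\<^bsub>\<Lambda>\<^esub> f' p \<otimes>\<^bsub>\<Lambda>\<^esub> scalar (A i p)"
          using B_in(2) f by (simp add: B_add l_distr)
      qed (use B_in_fibre[OF _ v] f in auto)
      also have "\<dots> = \<phi> k f i v \<oplus>\<^bsub>\<Lambda>\<^esub> \<phi> k f' i v"
        unfolding \<phi>_eq[OF i v] by (rule finsum_addf) (use B_in_fibre[OF _ v] f in auto)
      finally show "\<phi> k (f \<oplus>\<^bsub>obj B k\<^esub> f') i v = (\<phi> k f \<oplus>\<^bsub>obj (cochain_dsum X C) k\<^esub> \<phi> k f') i v"
        by (simp add: D_add[OF i v])
    qed (use f \<phi>_into in auto)
    moreover have "\<phi> k (a \<odot>\<^bsub>obj B k\<^esub> f) = a \<odot>\<^bsub>obj (cochain_dsum X C) k\<^esub> \<phi> k f"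
      if a: "a \<in> carrier \<Lambda>" and f: "f \<in> carrier (obj B k)" for a f
    proof (rule D_ext)
      fix i v assume i: "i \<in> X" and v: "v \<in> Vw k"
      have "\<phi> k (a \<odot>\<^bsub>obj B k\<^esub> f) i v = (\<Oplus>\<^bsub>\<Lambda>\<^esub>p\<in>S v. a \<otimes>\<^bsub>\<Lambda>\<^esub> (f p \<otimes>\<^bsub>\<Lambda>\<^esub> scalar (A i p)))"
        unfolding \<phi>_eq[OF i v]
      proof (rule finsum_cong')
        fix p assume "p \<in> S v"
        then have "p \<in> Vs k" using S_Vs[OF v] by auto
        then show "(a \<odot>\<^bsub>obj B k\<^esub> f) p \<otimes>\<^bsub>\<Lambda>\<^esub> scalar (A i p) = a \<otimes>\<^bsub>\<Lambda>\<^esub> (f p \<otimes>\<^bsub>\<Lambda>\<^esub> scalar (A i p))"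
          using B_in(2) f a by (simp add: B_smult m_assoc)
      qed (use B_in_fibre[OF _ v] f a in auto)
      also have "\<dots> = a \<otimes>\<^bsub>\<Lambda>\<^esub> \<phi> k f i v"
        unfolding \<phi>_eq[OF i v] by (rule finsum_rdistr[OF S_fin a, symmetric]) (use B_in_fibre[OF _ v] f in auto)
      finally show "\<phi> k (a \<odot>\<^bsub>obj B k\<^esub> f) i v = (a \<odot>\<^bsub>obj (cochain_dsum X C) k\<^esub> \<phi> k f) i v"
        by (simp add: D_smult[OF i v])
    qed (use \<phi>_into M.smult_closed[OF a f] N.smult_closed[OF a \<phi>_into[OF f]] in auto)
    ultimately show ?thesis using \<phi>_into by (auto simp: lin_hom_def)
  qed
  have comm: "\<phi> (k + 1) (diff B k f) = diff (cochain_dsum X C) k (\<phi> k f)"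
    if f: "f \<in> carrier (obj B k)" for k f
  proof (rule D_ext)
    have df: "diff B k f \<in> carrier (obj B (k + 1))"
      using band_diff_closed[OF \<sigma>] f unfolding B_def by blast
    show "\<phi> (k + 1) (diff B k f) \<in> carrier (obj (cochain_dsum X C) (k + 1))" by (rule \<phi>_into[OF df])
    show "diff (cochain_dsum X C) k (\<phi> k f) \<in> carrier (obj (cochain_dsum X C) (k + 1))"
      using D_cplx \<phi>_into[OF f] by (auto simp: cochain_complex_def lin_hom_def Pi_iff)
    fix i v assume i: "i \<in> X" and v: "v \<in> Vw (k + 1)"
    \<comment> \<open>Both composites turn out to be the sum of \<open>G\<close> over the set \<open>U\<close> of the arrows of the cover
      above the arrows into \<open>v\<close>: one groups them by their targets, the other by the arrows below
      them.\<close>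
    define U where "U = {j. j < n * m \<and> arrow_target w (j mod m) = v}"
    define s where "s j = (if j = l then c else 1)" for j
    define t where "t j = (if j = b i then e i else 1)" for j
    define G where "G j = f (arrow_source \<sigma> j) \<otimes>\<^bsub>\<Lambda>\<^esub> arrow w (j mod m)
      \<otimes>\<^bsub>\<Lambda>\<^esub> scalar (A i (arrow_target \<sigma> j) * s j)" for j
    have arrows: "arrow w (j mod m) \<in> carrier \<Lambda>" for j
      using arrow_closed[OF w] m by (simp add: m_def)
    have tgt_mod: "arrow_target \<sigma> j mod m = arrow_target w (j mod m)"
      and src_mod: "arrow_source \<sigma> j mod m = arrow_source w (j mod m)" if "j < n * m" for j
      using arrow_ends_power[OF w0, of j n] that by (simp_all add: \<sigma>_def m_def)
    have f_src: "f (arrow_source \<sigma> j) \<in> carrier \<Lambda>" if "j \<in> U" for j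
    proof -
      have j: "j < length \<sigma>" "arrow_target w (j mod m) = v" using that by (auto simp: U_def len)
      have "arrow_target \<sigma> j \<in> Vs (k + 1)"
        using j v tgt_mod arrow_bounds(2)[of \<sigma> j] \<sigma> by (auto simp: Vs len cyclic_word_def)
      then show ?thesis
        using B_in(2)[OF f] arrow_source_of_degree[OF \<sigma> j(1)] by (simp add: Vs_def)
    qed
    have G_closed: "G j \<in> carrier \<Lambda>" if "j \<in> U" for j
      using f_src[OF that] arrows by (simp add: G_def)
    have U_fin: "finite U" by (simp add: U_def)
    have "\<phi> (k + 1) (diff B k f) i v = (\<Oplus>\<^bsub>\<Lambda>\<^esub>p\<in>S v. \<Oplus>\<^bsub>\<Lambda>\<^esub>j\<in>{j \<in> U. arrow_target \<sigma> j = p}. G j)"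
      unfolding \<phi>_eq[OF i v]
    proof (rule finsum_cong')
      fix p assume p: "p \<in> S v"
      then have pV: "p \<in> vertices_of_degree d \<sigma> (k + 1)" using S_Vs[OF v] by (auto simp: Vs_def)
      have U: "{j. j < length \<sigma> \<and> arrow_target \<sigma> j = p} = {j \<in> U. arrow_target \<sigma> j = p}"
        using p tgt_mod by (auto simp: U_def len S_def)
      have "diff B k f p \<otimes>\<^bsub>\<Lambda>\<^esub> scalar (A i p) = (\<Oplus>\<^bsub>\<Lambda>\<^esub>j\<in>{j \<in> U. arrow_target \<sigma> j = p}.
          f (arrow_source \<sigma> j) \<otimes>\<^bsub>\<Lambda>\<^esub> arrow \<sigma> j \<otimes>\<^bsub>\<Lambda>\<^esub> scalar (s j)) \<otimes>\<^bsub>\<Lambda>\<^esub> scalar (A i p)"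
        unfolding B_def band_diff[OF \<sigma> f[unfolded B_def] pV] U s_def ..
      also have "\<dots> = (\<Oplus>\<^bsub>\<Lambda>\<^esub>j\<in>{j \<in> U. arrow_target \<sigma> j = p}.
          f (arrow_source \<sigma> j) \<otimes>\<^bsub>\<Lambda>\<^esub> arrow \<sigma> j \<otimes>\<^bsub>\<Lambda>\<^esub> scalar (s j) \<otimes>\<^bsub>\<Lambda>\<^esub> scalar (A i p))"
        by (rule finsum_ldistr) (use U_fin f_src arrows in \<open>auto simp: nth U_def\<close>)
      also have "\<dots> = (\<Oplus>\<^bsub>\<Lambda>\<^esub>j\<in>{j \<in> U. arrow_target \<sigma> j = p}. G j)"
        by (rule finsum_cong')
          (use f_src arrows in \<open>auto simp: nth U_def G_def m_assoc mult.commute[of "A _ _"] scalar_mult\<close>)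
      finally show "diff B k f p \<otimes>\<^bsub>\<Lambda>\<^esub> scalar (A i p) = (\<Oplus>\<^bsub>\<Lambda>\<^esub>j\<in>{j \<in> U. arrow_target \<sigma> j = p}. G j)" .
    qed (use G_closed in \<open>auto intro!: finsum_closed\<close>)
    also have "\<dots> = (\<Oplus>\<^bsub>\<Lambda>\<^esub>j\<in>U. G j)"
    proof (rule finsum_group[OF U_fin S_fin])
      show "arrow_target \<sigma> ` U \<subseteq> S v"
        using tgt_mod arrow_bounds(2)[of \<sigma>] \<sigma> by (auto simp: U_def S_def len cyclic_word_def)
    qed (rule G_closed)
    also have "\<dots> = (\<Oplus>\<^bsub>\<Lambda>\<^esub>j\<in>{j. j < m \<and> arrow_target w j = v}. \<Oplus>\<^bsub>\<Lambda>\<^esub>J\<in>{J \<in> U. J mod m = j}. G J)"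
      by (rule finsum_group[symmetric]) (use U_fin G_closed m in \<open>auto simp: U_def\<close>)
    also have "\<dots> = diff (C i) k (\<phi> k f i) v"
    proof -
      have vV: "v \<in> vertices_of_degree d w (k + 1)" using v by (simp add: Vw_def)
      have \<phi>C: "\<phi> k f i \<in> carrier (obj (band_complex Q I d w (b i) (e i)) k)"
        using \<phi>_into[OF f] i by (auto simp: D_carrier band_obj_carrier Vw_def)
      have "diff (C i) k (\<phi> k f i) v = (\<Oplus>\<^bsub>\<Lambda>\<^esub>j\<in>{j. j < m \<and> arrow_target w j = v}.
          \<phi> k f i (arrow_source w j) \<otimes>\<^bsub>\<Lambda>\<^esub> arrow w j \<otimes>\<^bsub>\<Lambda>\<^esub> scalar (t j))"
        unfolding C_def band_diff[OF w \<phi>C vV] m_def t_def ..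
      also have "\<dots> = (\<Oplus>\<^bsub>\<Lambda>\<^esub>j\<in>{j. j < m \<and> arrow_target w j = v}. \<Oplus>\<^bsub>\<Lambda>\<^esub>J\<in>{J \<in> U. J mod m = j}. G J)"
      proof (rule finsum_cong')
        fix j assume j: "j \<in> {j. j < m \<and> arrow_target w j = v}"
        then have jw: "j < length w" and aj: "arrow w j \<in> carrier \<Lambda>"
          using arrow_closed[OF w] by (auto simp: m_def)
        have src: "arrow_source w j \<in> Vw k"
          using arrow_source_of_degree[OF w jw] j v by (simp add: Vw_def)
        have UJ: "{J \<in> U. J mod m = j} = S j" using j by (auto simp: U_def S_def)
        have bij: "bij_betw (arrow_source \<sigma>) (S j) (S (arrow_source w j))"
          unfolding S_def \<sigma>_def m_def by (rule arrow_source_power_bij[OF w0 jw])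
        have fS: "f p \<in> carrier \<Lambda>" if "p \<in> S (arrow_source w j)" for p
          using B_in(2)[OF f] S_Vs[OF src] that by blast
        have f_src_j: "f (arrow_source \<sigma> J) \<in> carrier \<Lambda>" if "J \<in> S j" for J
          using f_src UJ that by blast
        have "\<phi> k f i (arrow_source w j) = (\<Oplus>\<^bsub>\<Lambda>\<^esub>p\<in>arrow_source \<sigma> ` S j. f p \<otimes>\<^bsub>\<Lambda>\<^esub> scalar (A i p))"
          unfolding \<phi>_eq[OF i src] bij_betw_imp_surj_on[OF bij] ..
        also have "\<dots> = (\<Oplus>\<^bsub>\<Lambda>\<^esub>J\<in>S j. f (arrow_source \<sigma> J) \<otimes>\<^bsub>\<Lambda>\<^esub> scalar (A i (arrow_source \<sigma> J)))"
          by (rule finsum_reindex[OF _ bij_betw_imp_inj_on[OF bij]])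
            (use fS bij_betw_imp_surj_on[OF bij] in auto)
        finally have "\<phi> k f i (arrow_source w j) \<otimes>\<^bsub>\<Lambda>\<^esub> arrow w j \<otimes>\<^bsub>\<Lambda>\<^esub> scalar (t j)
          = (\<Oplus>\<^bsub>\<Lambda>\<^esub>J\<in>S j. f (arrow_source \<sigma> J) \<otimes>\<^bsub>\<Lambda>\<^esub> scalar (A i (arrow_source \<sigma> J)))
            \<otimes>\<^bsub>\<Lambda>\<^esub> (arrow w j \<otimes>\<^bsub>\<Lambda>\<^esub> scalar (t j))"
          using f_src_j aj by (subst m_assoc[symmetric]) (auto intro!: finsum_closed)
        also have "\<dots> = (\<Oplus>\<^bsub>\<Lambda>\<^esub>J\<in>S j. f (arrow_source \<sigma> J) \<otimes>\<^bsub>\<Lambda>\<^esub> scalar (A i (arrow_source \<sigma> J))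
            \<otimes>\<^bsub>\<Lambda>\<^esub> (arrow w j \<otimes>\<^bsub>\<Lambda>\<^esub> scalar (t j)))"
          by (rule finsum_ldistr[OF S_fin]) (use f_src_j aj in auto)
        also have "\<dots> = (\<Oplus>\<^bsub>\<Lambda>\<^esub>J\<in>S j. G J)"
        proof (rule finsum_cong')
          fix J assume J: "J \<in> S j"
          then have "A i (arrow_target \<sigma> J) * s J = A i (arrow_source \<sigma> J) * t j"
            using compat[OF i, of J] by (simp add: s_def t_def S_def)
          then show "f (arrow_source \<sigma> J) \<otimes>\<^bsub>\<Lambda>\<^esub> scalar (A i (arrow_source \<sigma> J))
              \<otimes>\<^bsub>\<Lambda>\<^esub> (arrow w j \<otimes>\<^bsub>\<Lambda>\<^esub> scalar (t j)) = G J"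
            using J f_src_j[OF J] aj by (simp add: G_def S_def scalar_slide)
        qed (use G_closed UJ in auto)
        finally show "\<phi> k f i (arrow_source w j) \<otimes>\<^bsub>\<Lambda>\<^esub> arrow w j \<otimes>\<^bsub>\<Lambda>\<^esub> scalar (t j)
          = (\<Oplus>\<^bsub>\<Lambda>\<^esub>J\<in>{J \<in> U. J mod m = j}. G J)" unfolding UJ .
      qed (use G_closed in \<open>auto intro!: finsum_closed\<close>)
      finally show ?thesis by simp
    qed
    also have "\<dots> = diff (cochain_dsum X C) k (\<phi> k f) i v"
      using i by (simp add: cochain_dsum_def)
    finally show "\<phi> (k + 1) (diff B k f) i v = diff (cochain_dsum X C) k (\<phi> k f) i v" .
  qed
  have "cochain_isomorphic \<Lambda> B (cochain_dsum X C)"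
    unfolding cochain_isomorphic_def using B_cplx D_cplx lin bij comm by (intro conjI exI[of _ \<phi>]) auto
  then show ?thesis unfolding B_def C_def[abs_def] .
qed

end



section \<open>The decomposition\<close>

text \<open>
  Up to normalisation, these are the only weights compatible with the arrows. Start with weight \<open>1\<close> at
  vertex \<open>0\<close> of the cover and walk along the word: passing the letter \<open>l\<close> multiplies the weight by
  \<open>c\<close>, and passing a letter above the letter \<open>b\<close> divides it by \<open>\<nu>\<close>. On the way to the vertex \<open>p\<close> the
  second event occurs once for each of the \<open>p div m\<close> completed turns, and once more if \<open>b\<close> has been
  passed in the current turn.
\<close>

definition cover_weight :: "nat \<Rightarrow> nat \<Rightarrow> 'k::field \<Rightarrow> nat \<Rightarrow> 'k \<Rightarrow> nat \<Rightarrow> 'k" where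
  "cover_weight m l c b \<nu> p =
    (if l < p then c else 1) / \<nu> ^ (p div m + (if b < p mod m then 1 else 0))"

text \<open>Within the word this holds by construction. At the last vertex it holds because the whole
  circuit multiplies the weight by \<open>c / \<nu>\<^sup>n = 1\<close>.\<close>

lemma cover_weight_step:
  assumes m: "b < m" and p: "p < n * m" and l: "l < n * m" and \<nu>: "\<nu> ^ n = c" "c \<noteq> 0"
  shows "cover_weight m l c b \<nu> (Suc p mod (n * m)) * (if p mod m = b then \<nu> else 1)
    = cover_weight m l c b \<nu> p * (if p = l then c else 1)"
proof -
  have n0: "n > 0" and m0: "m > 0" using p m by (cases n; simp)+
  then have \<nu>0: "\<nu> \<noteq> 0" using \<nu> by (auto simp: power_0_left)
  define v where "v = p mod m"
  have v: "v < m" using m0 by (simp add: v_def)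
  show ?thesis
  proof (cases "Suc v = m")
    case False
    then have "Suc p mod m = Suc v" "Suc p div m = p div m"
      by (simp_all add: v_def mod_Suc div_Suc)
    moreover have "Suc p \<noteq> n * m" using calculation(1) by (auto simp: v_def)
    then have "Suc p mod (n * m) = Suc p" using p by simp
    ultimately show ?thesis
      using \<nu>0 by (auto simp: cover_weight_def less_Suc_eq simp flip: v_def)
  next
    case True
    then have s: "Suc p mod m = 0" "Suc p div m = Suc (p div m)"
      by (simp_all add: v_def mod_Suc div_Suc)
    show ?thesis
    proof (cases "Suc p = n * m")
      case True
      then have "Suc (p div m) = n" using s m0 by simp
      then have "c = \<nu> * \<nu> ^ (p div m)" using \<nu>(1) by auto
      moreover have "l < p \<or> p = l" using l True by auto
      ultimately show ?thesis
        using True \<open>Suc v = m\<close> m \<nu>0 \<nu>(2) by (auto simp: cover_weight_def less_Suc_eq simp flip: v_def)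
    next
      case False
      then have "Suc p mod (n * m) = Suc p" using p by simp
      then show ?thesis
        using s \<open>Suc v = m\<close> m \<nu>0 by (auto simp: cover_weight_def less_Suc_eq simp flip: v_def)
    qed
  qed
qed

lemma sum_fibre_mod:
  fixes g :: "nat \<Rightarrow> 'k::comm_monoid_add"
  assumes "v < m"
  shows "(\<Sum>p | p < n * m \<and> p mod m = v. g p) = (\<Sum>k<n. g (k * m + v))"
proof -
  have "k * m + v < n * m" if "k < n" for k
  proof -
    have "k * m + v < Suc k * m" using assms by simp
    also have "\<dots> \<le> n * m" using that by (intro mult_le_mono1) simp
    finally show ?thesis .
  qed
  then show ?thesis
    using assms
    by (intro sum.reindex_bij_witness[of _ "\<lambda>k. k * m + v" "\<lambda>p. p div m"])
      (auto simp: less_mult_imp_div_less)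
qed

theorem lemma2p5:
  fixes Q :: "('v, 'a) pre_digraph"
    and I :: "(('v, 'a) qpath \<Rightarrow> 'k::alg_closed_field) set"
    and \<tau> \<sigma> :: "('v, 'a) letter list"
    and n l :: nat and b :: "nat \<Rightarrow> nat" and d :: int
    and c \<mu> \<omega> :: 'k
  assumes "gentle_algebra Q I"
    and "homotopy_band Q I \<tau>"
    and "n \<ge> 1"
    and "\<sigma> = word_power \<tau> n"
    and "c \<noteq> 0"
    and "l < length \<sigma>" and "is_direct (\<sigma> ! l)"
    and "\<And>i. i \<in> {1..n} \<Longrightarrow> b i < length \<tau> \<and> is_direct (\<tau> ! b i)"
    and "\<mu> ^ n = c"
    and "primitive_root_of_unity n \<omega>"
  shows "cochain_isomorphic (bound_algebra Q I)
    (band_complex Q I d \<sigma> l c)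
    (cochain_dsum {1..n} (\<lambda>i. band_complex Q I d \<tau> (b i) (\<omega> ^ i * \<mu>)))"
proof -
  interpret gentle_algebra Q I by fact
  define m where "m = length \<tau>"
  define \<nu> where "\<nu> i = \<omega> ^ i * \<mu>" for i
  define x where "x i p = p div m + (if b i < p mod m then 1 else 0 :: nat)" for i p
  define A where "A i = cover_weight m l c (b i) (\<nu> i)" for i
  \<comment> \<open>On the fibre above \<open>v\<close>, \<open>A\<close> is the Vandermonde matrix of the inverses of the \<open>\<nu> i\<close> up to
    rescaling its rows and columns, so its inverse is the matrix of inverse entries divided by \<open>n\<close>.\<close>
  define N where "N p i = \<nu> i ^ x i p / ((if l < p then c else 1) * of_nat n)" for p i
  have \<omega>: "\<omega> ^ n = 1" "\<omega> \<noteq> 0"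
    using assms(10) by (auto simp: primitive_root_of_unity_def power_0_left)
  have \<mu>: "\<mu> \<noteq> 0" using assms(3,5,9) by (auto simp: power_0_left)
  have \<nu>n: "\<nu> i ^ n = c" for i
    using \<omega> assms(9) by (simp add: \<nu>_def power_mult_distrib) (metis mult.commute mult_1 power_mult power_one)
  have \<nu>0: "\<nu> i \<noteq> 0" for i using \<omega> \<mu> by (simp add: \<nu>_def)
  have n0: "(of_nat n :: 'k) \<noteq> 0" by (rule primitive_root_order_nonzero[OF assms(10)])
  have len: "length \<sigma> = n * m" by (simp add: assms(4) word_power_length m_def)
  have nth: "\<sigma> ! j = \<tau> ! (j mod m)" if "j < n * m" for j
    using that by (simp add: assms(4) word_power_nth m_def)
  have A_eq: "A i p = (if l < p then c else 1) / \<nu> i ^ x i p" for i p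
    by (simp add: A_def cover_weight_def x_def)
  have ratio: "A i q * N p i' = (if l < q then c else 1) / (if l < p then c else 1)
      * (\<nu> i' ^ x i' p / \<nu> i ^ x i q) / of_nat n" for i i' p q
    by (simp add: A_eq N_def)
  have "cochain_isomorphic \<Lambda> (band_complex Q I d (word_power \<tau> n) l c)
    (cochain_dsum {1..n} (\<lambda>i. band_complex Q I d \<tau> (b i) (\<nu> i)))"
  proof (rule power_complex_iso_by_matrices[where A = A and N = N])
    show "cyclic_word Q I \<tau>" using assms(2) by (rule homotopy_band_cyclic_word)
    show "n \<ge> 1" by fact
    show "finite {1..n}" by simp
  next
    fix i j assume i: "i \<in> {1..n}" and "j < n * length \<tau>"
    then have j: "j < n * m" by (simp add: m_def)
    have b: "b i < m" "is_direct (\<tau> ! b i)" using assms(8)[OF i] by (auto simp: m_def)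
    have step: "A i (Suc j mod length \<sigma>) * (if j mod m = b i then \<nu> i else 1) = A i j * (if j = l then c else 1)"
      using cover_weight_step[OF b(1) j, of l "\<nu> i" c] \<nu>n assms(5,6) by (simp add: A_def len)
    have "A i (arrow_target \<sigma> j) * (if j = l then c else 1)
        = A i (arrow_source \<sigma> j) * (if j mod m = b i then \<nu> i else 1)"
    \<comment> \<open>An inverse letter interchanges source and target, but then both scalars are \<open>1\<close>.\<close>
    proof (cases "is_direct (\<sigma> ! j)")
      case True
      then show ?thesis
        using step by (simp add: arrow_source_def arrow_target_def)
    next
      case False
      then have "j \<noteq> l" "j mod m \<noteq> b i" using assms(7) b nth[OF j] by auto
      then show ?thesis
        using step False by (simp add: arrow_source_def arrow_target_def)
    qed
    then show "A i (arrow_target (word_power \<tau> n) j) * (if j = l then c else 1)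
        = A i (arrow_source (word_power \<tau> n) j) * (if j mod length \<tau> = b i then \<nu> i else 1)"
      by (simp add: assms(4) m_def)
  next
    fix i i' v assume i: "i \<in> {1..n}" "i' \<in> {1..n}" and "v < length \<tau>"
    then have v: "v < m" by (simp add: m_def)
    let ?r = "\<nu> i' ^ (if b i' < v then 1 else 0) / \<nu> i ^ (if b i < v then 1 else 0) / of_nat n"
    have "(\<Sum>p | p < n * m \<and> p mod m = v. N p i' * A i p)
        = (\<Sum>p | p < n * m \<and> p mod m = v. ?r * (\<nu> i' ^ (p div m) / \<nu> i ^ (p div m)))"
      using assms(5) by (intro sum.cong refl) (simp add: mult.commute[of "N _ _"] ratio x_def power_add mult_ac)
    also have "\<dots> = ?r * (\<Sum>k<n. \<nu> i' ^ k / \<nu> i ^ k)"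
      unfolding sum_fibre_mod[OF v] using v by (simp add: sum_distrib_left)
    also have "\<dots> = (if i = i' then 1 else 0)"
      using dft_orthogonality(1)[OF assms(10) \<mu> i] \<nu>0 n0 by (simp add: \<nu>_def[symmetric])
    finally show "(\<Sum>p | p < n * length \<tau> \<and> p mod length \<tau> = v. N p i' * A i p) = (if i = i' then 1 else 0)"
      by (simp add: m_def)
  next
    fix p q assume "p < n * length \<tau>" "q < n * length \<tau>" "p mod length \<tau> = q mod length \<tau>"
    then have pq: "p < n * m" "q < n * m" "p mod m = q mod m" by (simp_all add: m_def)
    let ?r = "(if l < q then c else 1) / (if l < p then c else 1) / of_nat n"
    have div: "p div m < n" "q div m < n" using pq by (simp_all add: less_mult_imp_div_less)
    have "(\<Sum>i\<in>{1..n}. A i q * N p i) = (\<Sum>i\<in>{1..n}. ?r * (\<nu> i ^ (p div m) / \<nu> i ^ (q div m)))"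
      using \<nu>0 pq by (intro sum.cong refl) (simp add: ratio x_def power_add)
    also have "\<dots> = ?r * (\<Sum>i\<in>{1..n}. \<nu> i ^ (p div m) / \<nu> i ^ (q div m))"
      by (simp only: sum_distrib_left)
    also have "\<dots> = ?r * (if q div m = p div m then of_nat n else 0)"
      using dft_orthogonality(2)[OF assms(10) \<mu> div(2,1)] by (simp add: \<nu>_def[symmetric])
    also have "\<dots> = (if p = q then 1 else 0)"
      proof (cases "p = q")
      case False
      then have "q div m \<noteq> p div m" using pq(3) by (metis div_mult_mod_eq)
      then show ?thesis using False by simp
    qed (use n0 assms(5) in simp)
    finally show "(\<Sum>i\<in>{1..n}. A i q * N p i) = (if p = q then 1 else 0)" .
  qed
  then show ?thesis by (simp add: assms(4) \<nu>_def)
qed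

end
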